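(* Let $S_{n-1}=\operatorname{conv}(e_1,\ldots,e_n)\subset\mathbb{R}^n$ and $C_n=\operatorname{conv}(\pm e_1,\ldots,\pm e_n)\subset\mathbb{R}^n$, where $e_1,\dots,e_n$ is the standard basis. For a convex compact $K\subset\mathbb{R}^n$ let $W_K=\sup_{t\in K}\langle U,t\rangle-\inf_{t\in K}\langle U,t\rangle$, where $U$ is uniformly distributed on the unit sphere $\mathbb{S}^{n-1}$. Let $$u_n = \sqrt{2\log n} - \frac{\frac 12 \log \log n +\log (2\sqrt{\pi})}{\sqrt{2\log n}}.$$ Then, as $n\to\infty$, in distribution, $$\sqrt{2n\log n} \left(W_{S_{n-1}} - \frac{2 u_{n}}{\sqrt n} \right) \to G_1+G_2,\qquad \sqrt{2n\log n} \left(W_{C_{n}} - \frac{2 u_{2n}}{\sqrt n} \right) \to 2G_1,$$ where $G_1,G_2$ are independent random variables with $\mathbb{P}[G_1\leq x]=\mathbb{P}[G_2\leq x]=e^{-e^{-x}}$, $x\in\mathbb{R}$. *)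

theory Defs
  imports "HOL-Probability.Probability"
begin

text \<open>Vectors of R^n are represented as functions nat => real; only the
  coordinates 0..n-1 matter.\<close>

definition std_basis :: "nat \<Rightarrow> nat \<Rightarrow> real" where
  "std_basis i = (\<lambda>j. if j = i then 1 else 0)"

definition conv_fin :: "(nat \<Rightarrow> real) set \<Rightarrow> (nat \<Rightarrow> real) set" where
  "conv_fin V = {x. \<exists>F a. finite F \<and> F \<subseteq> V \<and> F \<noteq> {} \<and> (\<forall>v\<in>F. a v \<ge> 0) \<and>
      sum a F = 1 \<and> x = (\<lambda>j. \<Sum>v\<in>F. a v * v j)}"

definition simplex_n :: "nat \<Rightarrow> (nat \<Rightarrow> real) set" where
  "simplex_n n = conv_fin (std_basis ` {..<n})"

definition crosspoly_n :: "nat \<Rightarrow> (nat \<Rightarrow> real) set" where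
  "crosspoly_n n = conv_fin ((\<lambda>(s, i). (\<lambda>j. s * std_basis i j)) ` ({1, -1} \<times> {..<n}))"

definition inner_n :: "nat \<Rightarrow> (nat \<Rightarrow> real) \<Rightarrow> (nat \<Rightarrow> real) \<Rightarrow> real" where
  "inner_n n x y = (\<Sum>i<n. x i * y i)"

definition width_n :: "nat \<Rightarrow> (nat \<Rightarrow> real) set \<Rightarrow> (nat \<Rightarrow> real) \<Rightarrow> real" where
  "width_n n K U = (SUP t\<in>K. inner_n n U t) - (INF t\<in>K. inner_n n U t)"

definition lebesgue_n :: "nat \<Rightarrow> (nat \<Rightarrow> real) measure" where
  "lebesgue_n n = PiM {..<n} (\<lambda>_. lborel)"

definition unit_ball_n :: "nat \<Rightarrow> (nat \<Rightarrow> real) set" where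
  "unit_ball_n n = {x \<in> PiE {..<n} (\<lambda>_. UNIV). (\<Sum>i<n. (x i)\<^sup>2) \<le> 1}"

text \<open>Uniform (normalized surface) measure on the unit sphere S^{n-1}, defined
  as the cone measure: push-forward of the uniform distribution on the unit
  ball under radial projection x \<mapsto> x / |x|.\<close>
definition sphere_unif :: "nat \<Rightarrow> (nat \<Rightarrow> real) measure" where
  "sphere_unif n = distr (uniform_measure (lebesgue_n n) (unit_ball_n n)) (lebesgue_n n)
     (\<lambda>x. restrict (\<lambda>i. x i / sqrt (\<Sum>j<n. (x j)\<^sup>2)) {..<n})"

definition u_seq :: "nat \<Rightarrow> real" where
  "u_seq n = sqrt (2 * ln (real n))
     - ((1/2) * ln (ln (real n)) + ln (2 * sqrt pi)) / sqrt (2 * ln (real n))"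

end

theory Submission
  imports Defs "HOL-Real_Asymp.Real_Asymp"
begin

text \<open>
  The width of the simplex in direction \<open>U\<close> is \<open>max U\<^sub>i - min U\<^sub>i\<close>, that of the cross-polytope is
  \<open>2 max \<bar>U\<^sub>i\<bar>\<close>, so everything is governed by the probabilities of boxes \<open>-b \<le> \<surd>n U\<^sub>i \<le> a\<close>.
  By homogeneity of Lebesgue measure, a cone has the same mass under every probability measure with
  a radial density; hence \<open>U\<close>, the direction of a uniform point of the ball, has the law of \<open>Z / \<bar>Z\<bar>\<close>
  for a standard Gaussian \<open>Z\<close>. By Chebyshev \<open>\<bar>Z\<bar> / \<surd>n\<close> differs from \<open>1\<close> by at most \<open>n powr (-1/4)\<close> with
  high probability, which is negligible at the scale of \<open>u\<^sub>n\<close>; so the box probability is asymptotically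
  \<open>(1 - Q a - Q b) ^ n\<close> with \<open>Q\<close> the Gaussian tail, and by the Mills ratio \<open>n Q a\<^sub>n\<close> tends to \<open>exp (-x)\<close>
  when \<open>\<surd>(2 log n) (a\<^sub>n - u\<^sub>n)\<close> tends to \<open>x\<close>. Maximum and minimum are thus asymptotically independent,
  and joint convergence of distribution functions passes to the sum by approximating half planes by
  staircases.
\<close>

subsection \<open>The Gaussian tail\<close>

interpretation std_normal: real_distribution std_normal_distribution
  by (rule real_dist_normal_dist)

definition normal_tail :: "real \<Rightarrow> real" where
  "normal_tail a = measure std_normal_distribution {a<..}"

lemma distr_std_normal_uminus: "distr std_normal_distribution borel uminus = std_normal_distribution"
proof -
  have "distributed std_normal_distribution lborel (\<lambda>x. x) std_normal_density"
    by (simp add: distributed_def distr_id2)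
  from std_normal.normal_density_affine[OF this, of "-1" 0]
  have "distributed std_normal_distribution lborel uminus std_normal_density"
    by simp
  then show ?thesis
    by (simp add: distributed_def cong: distr_cong)
qed

lemma measure_std_normal_Icc:
  assumes "- b \<le> a"
  shows "measure std_normal_distribution {-b..a} = 1 - (normal_tail a + normal_tail b)"
proof -
  have "measure std_normal_distribution {..<-b}
      = measure (distr std_normal_distribution borel uminus) {..<-b}"
    by (simp only: distr_std_normal_uminus)
  also have "\<dots> = measure std_normal_distribution (uminus -` {..<-b})"
    by (subst measure_distr) auto
  also have "uminus -` {..<-b} = {b<..}" by auto
  finally have left: "measure std_normal_distribution {..<-b} = normal_tail b"
    by (simp add: normal_tail_def)
  have "measure std_normal_distribution (- {-b..a}) = measure std_normal_distribution ({..<-b} \<union> {a<..})"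
    by (rule arg_cong[where f = "measure _"]) auto
  also have "\<dots> = normal_tail b + normal_tail a"
    using assms by (subst std_normal.finite_measure_Union) (auto simp: left normal_tail_def)
  finally show ?thesis
    using std_normal.prob_compl[of "{-b..a}"] by (simp add: Compl_eq_Diff_UNIV)
qed

lemma nn_integral_normal_tail:
  "ennreal (normal_tail a) = (\<integral>\<^sup>+x. ennreal (std_normal_density x) * indicator {a..} x \<partial>lborel)"
proof -
  have "ennreal (normal_tail a) = (\<integral>\<^sup>+x. ennreal (std_normal_density x) * indicator {a<..} x \<partial>lborel)"
    unfolding normal_tail_def std_normal.emeasure_eq_measure[symmetric] by (subst emeasure_density) auto
  also have "\<dots> = (\<integral>\<^sup>+x. ennreal (std_normal_density x) * indicator {a..} x \<partial>lborel)"
    using AE_lborel_singleton[of a]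
    by (intro nn_integral_cong_AE) (auto elim!: eventually_mono split: split_indicator)
  finally show ?thesis .
qed

lemma nn_integral_std_normal_density_Mills:
  assumes "a > 0"
  shows "(\<integral>\<^sup>+x. ennreal (std_normal_density x * (1 + 1 / x\<^sup>2)) * indicator {a..} x \<partial>lborel)
    = ennreal (std_normal_density a / a)"
proof -
  have "((\<lambda>x. - std_normal_density x / x) has_real_derivative
      std_normal_density x * (1 + 1 / x\<^sup>2)) (at x)"
    if "a \<le> x" for x
  proof -
    have "((\<lambda>x. - (1 / sqrt (2 * pi)) * (exp (- x\<^sup>2 / 2) / x)) has_real_derivative
        - (1 / sqrt (2 * pi)) * (- (exp (- x\<^sup>2 / 2) * (1 + 1 / x\<^sup>2)))) (at x)"
      using that assms by (intro DERIV_cmult)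
        (auto intro!: derivative_eq_intros simp: field_simps power2_eq_square)
    then show ?thesis by (simp add: std_normal_density_def)
  qed
  moreover have "((\<lambda>x. - std_normal_density x / x) \<longlongrightarrow> 0) at_top"
    unfolding std_normal_density_def by real_asymp
  ultimately have "(\<integral>\<^sup>+x. ennreal (std_normal_density x * (1 + 1 / x\<^sup>2)) * indicator {a..} x \<partial>lborel)
      = ennreal (0 - (- std_normal_density a / a))"
    by (intro nn_integral_FTC_atLeast) auto
  then show ?thesis by simp
qed

lemma normal_tail_le:
  assumes "a > 0"
  shows "normal_tail a \<le> std_normal_density a / a"
proof -
  have "ennreal (normal_tail a)
      \<le> (\<integral>\<^sup>+x. ennreal (std_normal_density x * (1 + 1 / x\<^sup>2)) * indicator {a..} x \<partial>lborel)"
    unfolding nn_integral_normal_tail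
    by (intro nn_integral_mono mult_right_mono ennreal_leI)
       (auto simp: mult_le_cancel_left1 leD[OF normal_density_nonneg])
  then show ?thesis
    using assms by (simp add: nn_integral_std_normal_density_Mills)
qed

lemma normal_tail_ge:
  assumes "a > 0"
  shows "std_normal_density a / a / (1 + 1 / a\<^sup>2) \<le> normal_tail a"
proof -
  have "std_normal_density x * (1 + 1 / x\<^sup>2) \<le> (1 + 1 / a\<^sup>2) * std_normal_density x" if "a \<le> x" for x
  proof -
    have "1 / x\<^sup>2 \<le> 1 / a\<^sup>2" using that assms by (intro divide_left_mono power_mono) auto
    then show ?thesis by (subst mult.commute) (intro mult_right_mono, auto)
  qed
  then have "ennreal (std_normal_density a / a)
      \<le> (\<integral>\<^sup>+x. ennreal (1 + 1 / a\<^sup>2) * (ennreal (std_normal_density x) * indicator {a..} x) \<partial>lborel)"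
    unfolding nn_integral_std_normal_density_Mills[OF assms, symmetric]
    by (intro nn_integral_mono)
       (simp add: ennreal_mult'[symmetric] del: ennreal_plus split: split_indicator)
  also have "\<dots> = ennreal (1 + 1 / a\<^sup>2) * ennreal (normal_tail a)"
    by (subst nn_integral_cmult) (auto simp: nn_integral_normal_tail)
  also have "\<dots> = ennreal ((1 + 1 / a\<^sup>2) * normal_tail a)"
    by (simp add: ennreal_mult normal_tail_def del: ennreal_plus)
  finally have "std_normal_density a / a \<le> (1 + 1 / a\<^sup>2) * normal_tail a"
    by (subst (asm) ennreal_le_iff)
       (auto simp: normal_tail_def intro!: mult_nonneg_nonneg add_nonneg_nonneg)
  moreover have "0 < 1 + 1 / a\<^sup>2" by (simp add: add_pos_nonneg)
  ultimately show ?thesis by (subst pos_divide_le_eq) (simp_all add: mult.commute)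
qed

subsection \<open>Levels of Gumbel type\<close>

definition gumbel_level :: "(nat \<Rightarrow> real) \<Rightarrow> real \<Rightarrow> bool" where
  "gumbel_level a x \<longleftrightarrow> (\<lambda>n. sqrt (2 * ln n) * (a n - u_seq n)) \<longlonglongrightarrow> x"

lemma gumbel_level_diff_sqrt_ln:
  assumes "gumbel_level a x"
  shows "(\<lambda>n. a n - sqrt (2 * ln n)) \<longlonglongrightarrow> 0"
proof -
  have "(\<lambda>n. sqrt (2 * ln n) * (a n - u_seq n) * (1 / sqrt (2 * ln n)) + (u_seq n - sqrt (2 * ln n)))
      \<longlonglongrightarrow> x * 0 + 0"
  proof (intro tendsto_intros assms[unfolded gumbel_level_def])
    show "(\<lambda>n. 1 / sqrt (2 * ln (real n))) \<longlonglongrightarrow> 0" by real_asymp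
    show "(\<lambda>n. u_seq n - sqrt (2 * ln (real n))) \<longlonglongrightarrow> 0" unfolding u_seq_def by real_asymp
  qed
  moreover have "\<forall>\<^sub>F n in sequentially. sqrt (2 * ln n) * (a n - u_seq n) * (1 / sqrt (2 * ln n))
      + (u_seq n - sqrt (2 * ln n)) = a n - sqrt (2 * ln n)"
    using eventually_gt_at_top[of 1] by eventually_elim simp
  ultimately have "(\<lambda>n. a n - sqrt (2 * ln n)) \<longlonglongrightarrow> x * 0 + 0" by (rule Lim_transform_eventually)
  then show ?thesis by simp
qed

lemma gumbel_level_at_top:
  assumes "gumbel_level a x"
  shows "filterlim a at_top sequentially"
proof -
  have "filterlim (\<lambda>n::nat. sqrt (2 * ln n)) at_top sequentially" by real_asymp
  from filterlim_tendsto_add_at_top[OF gumbel_level_diff_sqrt_ln[OF assms] this]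
  show ?thesis by simp
qed

lemma gumbel_level_ratio_sqrt_ln:
  assumes "gumbel_level a x"
  shows "(\<lambda>n. a n / sqrt (2 * ln n)) \<longlonglongrightarrow> 1"
proof -
  have "(\<lambda>n. 1 + (a n - sqrt (2 * ln n)) * (1 / sqrt (2 * ln n))) \<longlonglongrightarrow> 1 + 0 * 0"
    by (intro tendsto_intros gumbel_level_diff_sqrt_ln[OF assms]) real_asymp
  moreover have "\<forall>\<^sub>F n in sequentially.
      1 + (a n - sqrt (2 * ln n)) * (1 / sqrt (2 * ln n)) = a n / sqrt (2 * ln n)"
    using eventually_gt_at_top[of 1] by eventually_elim (simp add: field_simps)
  ultimately have "(\<lambda>n. a n / sqrt (2 * ln n)) \<longlonglongrightarrow> 1 + 0 * 0" by (rule Lim_transform_eventually)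
  then show ?thesis by simp
qed

lemma scaled_Mills_ratio_eq:
  assumes "n > 1"
  shows "real n * (std_normal_density a / a)
    = exp (- (sqrt (2 * ln n) * (a - u_seq n)) - (a - sqrt (2 * ln n))\<^sup>2 / 2) / (a / sqrt (2 * ln n))"
proof -
  define t where "t = sqrt (2 * ln (real n))"
  have ln_pos: "ln (real n) > 0" using assms by simp
  then have t: "t > 0" "t\<^sup>2 = 2 * ln n" by (simp_all add: t_def)
  have u_seq_eq: "t * (a - u_seq n) = t * (a - t) + ln (ln n) / 2 + ln (2 * sqrt pi)"
    using t(1) by (simp add: u_seq_def t_def[symmetric] field_simps)
  have "a\<^sup>2 = t\<^sup>2 + 2 * (t * (a - t)) + (a - t)\<^sup>2"
    by (simp add: power2_eq_square algebra_simps)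
  moreover have "ln (sqrt (ln n)) = ln (ln n) / 2"
    using ln_pos by (simp add: ln_sqrt)
  ultimately have "- (t * (a - u_seq n)) - (a - t)\<^sup>2 / 2
      = ln n + - a\<^sup>2 / 2 - ln (sqrt (ln n)) - ln (2 * sqrt pi)"
    using t(2) unfolding u_seq_eq by argo
  then have "n * exp (- a\<^sup>2 / 2) / (sqrt (ln n) * (2 * sqrt pi))
      = exp (- (t * (a - u_seq n)) - (a - t)\<^sup>2 / 2)"
    using ln_pos assms by (simp only: exp_diff exp_add) simp
  moreover have "sqrt (2 * pi) * t = sqrt (ln n) * (2 * sqrt pi)"
    by (simp add: t_def real_sqrt_mult)
  moreover have "real n * (std_normal_density a / a)
      = n * exp (- a\<^sup>2 / 2) / (sqrt (2 * pi) * t) / (a / t)"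
    using t(1) by (simp add: std_normal_density_def)
  ultimately show ?thesis
    by (simp only: t_def[symmetric])
qed

lemma gumbel_level_normal_tail:
  assumes a: "gumbel_level a x"
  shows "(\<lambda>n. real n * normal_tail (a n)) \<longlonglongrightarrow> exp (- x)"
proof -
  have pos: "\<forall>\<^sub>F n in sequentially. a n > 0"
    using gumbel_level_at_top[OF a] by (auto simp: filterlim_at_top_dense)
  have "(\<lambda>n. exp (- (sqrt (2 * ln n) * (a n - u_seq n)) - (a n - sqrt (2 * ln n))\<^sup>2 / 2)
        / (a n / sqrt (2 * ln n)))
      \<longlonglongrightarrow> exp (- x - 0\<^sup>2 / 2) / 1"
    by (intro tendsto_intros a[unfolded gumbel_level_def] gumbel_level_diff_sqrt_ln[OF a]
        gumbel_level_ratio_sqrt_ln[OF a]) auto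
  moreover have "\<forall>\<^sub>F n in sequentially.
      exp (- (sqrt (2 * ln n) * (a n - u_seq n)) - (a n - sqrt (2 * ln n))\<^sup>2 / 2)
        / (a n / sqrt (2 * ln n)) = real n * (std_normal_density (a n) / a n)"
    using eventually_gt_at_top[of 1] by eventually_elim (simp only: scaled_Mills_ratio_eq)
  ultimately have "(\<lambda>n. real n * (std_normal_density (a n) / a n)) \<longlonglongrightarrow> exp (- x - 0\<^sup>2 / 2) / 1"
    by (rule Lim_transform_eventually)
  then have upper: "(\<lambda>n. real n * (std_normal_density (a n) / a n)) \<longlonglongrightarrow> exp (- x)" by simp
  have "(\<lambda>n. real n * (std_normal_density (a n) / a n) / (1 + (inverse (a n))\<^sup>2)) \<longlonglongrightarrow> exp (- x) / (1 + 0\<^sup>2)"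
    by (intro tendsto_intros upper tendsto_inverse_0_at_top gumbel_level_at_top[OF a]) auto
  then have lower: "(\<lambda>n. real n * (std_normal_density (a n) / a n / (1 + 1 / (a n)\<^sup>2))) \<longlonglongrightarrow> exp (- x)"
    by (simp add: inverse_eq_divide power_one_over)
  show ?thesis
  proof (rule tendsto_sandwich[OF _ _ lower upper])
    show "\<forall>\<^sub>F n in sequentially.
        real n * (std_normal_density (a n) / a n / (1 + 1 / (a n)\<^sup>2)) \<le> real n * normal_tail (a n)"
      using pos by eventually_elim (intro mult_left_mono normal_tail_ge, auto)
    show "\<forall>\<^sub>F n in sequentially. real n * normal_tail (a n) \<le> real n * (std_normal_density (a n) / a n)"
      using pos by eventually_elim (intro mult_left_mono normal_tail_le, auto)
  qed
qed

lemma gumbel_level_rescale: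
  assumes a: "gumbel_level a x" and \<delta>: "(\<lambda>n. \<delta> n * ln (real n)) \<longlonglongrightarrow> 0"
  shows "gumbel_level (\<lambda>n. a n * (1 + \<delta> n)) x"
proof -
  have "(\<lambda>n. sqrt (2 * ln n) * (a n - u_seq n) + 2 * (\<delta> n * ln n) * (a n / sqrt (2 * ln n)))
      \<longlonglongrightarrow> x + 2 * 0 * 1"
    by (intro tendsto_intros a[unfolded gumbel_level_def] \<delta> gumbel_level_ratio_sqrt_ln[OF a])
  moreover have "\<forall>\<^sub>F n in sequentially.
      sqrt (2 * ln n) * (a n - u_seq n) + 2 * (\<delta> n * ln n) * (a n / sqrt (2 * ln n))
      = sqrt (2 * ln n) * (a n * (1 + \<delta> n) - u_seq n)"
    using eventually_gt_at_top[of 1]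
  proof eventually_elim
    case (elim n)
    have "2 * (\<delta> n * ln n) * (a n / sqrt (2 * ln n)) = \<delta> n * a n * (2 * ln n / sqrt (2 * ln n))"
      by simp
    also have "2 * ln n / sqrt (2 * ln n) = sqrt (2 * ln n)"
      using elim by (intro real_div_sqrt) simp
    finally show ?case by (simp only: algebra_simps)
  qed
  ultimately show ?thesis
    unfolding gumbel_level_def by (simp cong: filterlim_cong)
qed

lemma gumbel_level_u_seq:
  "gumbel_level (\<lambda>n. u_seq n + x / sqrt (2 * ln n)) x"
  unfolding gumbel_level_def
  by (rule tendsto_eventually, use eventually_gt_at_top[of 1] in eventually_elim) simp

lemma u_seq_double_diff_tendsto: "(\<lambda>n. sqrt (2 * ln n) * (u_seq (2 * n) - u_seq n)) \<longlonglongrightarrow> ln 2"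
  unfolding u_seq_def of_nat_mult of_nat_numeral
  by (real_asymp simp: powr_half_sqrt)

lemma gumbel_level_u_seq_double:
  "gumbel_level (\<lambda>n. u_seq (2 * n) + x / sqrt (2 * ln n)) (ln 2 + x)"
proof -
  have "(\<lambda>n. sqrt (2 * ln n) * (u_seq (2 * n) - u_seq n) + x) \<longlonglongrightarrow> ln 2 + x"
    by (intro tendsto_intros u_seq_double_diff_tendsto)
  moreover have "\<forall>\<^sub>F n in sequentially. sqrt (2 * ln n) * (u_seq (2 * n) - u_seq n) + x
      = sqrt (2 * ln n) * (u_seq (2 * n) + x / sqrt (2 * ln n) - u_seq n)"
    using eventually_gt_at_top[of 1] by eventually_elim (simp add: algebra_simps)
  ultimately show ?thesis
    unfolding gumbel_level_def by (simp cong: filterlim_cong)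
qed

subsection \<open>Finite products of measures\<close>

lemma PiM_distr:
  assumes I: "finite I" and "product_sigma_finite M"
    and sigma_finite: "product_sigma_finite (\<lambda>i. distr (M i) (N i) (f i))"
    and f: "\<And>i. i \<in> I \<Longrightarrow> f i \<in> measurable (M i) (N i)"
  shows "PiM I (\<lambda>i. distr (M i) (N i) (f i)) = distr (PiM I M) (PiM I N) (\<lambda>x. \<lambda>i\<in>I. f i (x i))"
proof -
  interpret M: product_sigma_finite M by fact
  have meas: "(\<lambda>x. \<lambda>i\<in>I. f i (x i)) \<in> measurable (PiM I M) (PiM I N)"
    using f by (intro measurable_restrict measurable_compose[OF measurable_component_singleton]) auto
  show ?thesis
  proof (rule product_sigma_finite.PiM_eqI[OF sigma_finite I, symmetric])
    fix A assume A: "\<And>i. i \<in> I \<Longrightarrow> A i \<in> sets (distr (M i) (N i) (f i))"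
    have "emeasure (distr (PiM I M) (PiM I N) (\<lambda>x. \<lambda>i\<in>I. f i (x i))) (Pi\<^sub>E I A)
        = emeasure (PiM I M) ((\<lambda>x. \<lambda>i\<in>I. f i (x i)) -` Pi\<^sub>E I A \<inter> space (PiM I M))"
      using A I by (intro emeasure_distr meas sets_PiM_I_finite) auto
    also have "(\<lambda>x. \<lambda>i\<in>I. f i (x i)) -` Pi\<^sub>E I A \<inter> space (PiM I M) = (\<Pi>\<^sub>E i\<in>I. f i -` A i \<inter> space (M i))"
      by (auto simp: space_PiM PiE_iff)
    also have "emeasure (PiM I M) \<dots> = (\<Prod>i\<in>I. emeasure (M i) (f i -` A i \<inter> space (M i)))"
      using I A f by (intro M.emeasure_PiM) (auto intro: measurable_sets)
    also have "\<dots> = (\<Prod>i\<in>I. emeasure (distr (M i) (N i) (f i)) (A i))"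
      using A f by (intro prod.cong) (auto simp: emeasure_distr)
    finally show "emeasure (distr (PiM I M) (PiM I N) (\<lambda>x. \<lambda>i\<in>I. f i (x i))) (Pi\<^sub>E I A)
        = (\<Prod>i\<in>I. emeasure (distr (M i) (N i) (f i)) (A i))" .
  qed (simp cong: sets_PiM_cong)
qed

lemma PiM_density:
  assumes I: "finite I" and "product_sigma_finite M"
    and sigma_finite: "product_sigma_finite (\<lambda>i. density (M i) (f i))"
    and f: "\<And>i. i \<in> I \<Longrightarrow> f i \<in> borel_measurable (M i)"
  shows "PiM I (\<lambda>i. density (M i) (f i)) = density (PiM I M) (\<lambda>x. \<Prod>i\<in>I. f i (x i))"
proof -
  interpret M: product_sigma_finite M by fact
  have meas: "(\<lambda>x. \<Prod>i\<in>I. f i (x i)) \<in> borel_measurable (PiM I M)"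
    using f by (intro borel_measurable_prod_ennreal)
      (rule measurable_compose[OF measurable_component_singleton])
  show ?thesis
  proof (rule product_sigma_finite.PiM_eqI[OF sigma_finite I, symmetric])
    fix A assume A: "\<And>i. i \<in> I \<Longrightarrow> A i \<in> sets (density (M i) (f i))"
    have "emeasure (density (PiM I M) (\<lambda>x. \<Prod>i\<in>I. f i (x i))) (Pi\<^sub>E I A)
        = (\<integral>\<^sup>+x. (\<Prod>i\<in>I. f i (x i)) * indicator (Pi\<^sub>E I A) x \<partial>PiM I M)"
      using A I by (intro emeasure_density meas sets_PiM_I_finite) auto
    also have "\<dots> = (\<integral>\<^sup>+x. (\<Prod>i\<in>I. f i (x i) * indicator (A i) (x i)) \<partial>PiM I M)"
    proof (intro nn_integral_cong)
      fix x assume "x \<in> space (PiM I M)"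
      then have "(indicator (Pi\<^sub>E I A) x :: ennreal) = (\<Prod>i\<in>I. indicator (A i) (x i))"
        using I by (cases "x \<in> Pi\<^sub>E I A") (auto simp: space_PiM PiE_iff intro!: bexI[rotated])
      then show "(\<Prod>i\<in>I. f i (x i)) * indicator (Pi\<^sub>E I A) x = (\<Prod>i\<in>I. f i (x i) * indicator (A i) (x i))"
        by (simp add: prod.distrib)
    qed
    also have "\<dots> = (\<Prod>i\<in>I. \<integral>\<^sup>+x. f i x * indicator (A i) x \<partial>M i)"
      using A I f by (intro M.product_nn_integral_prod) auto
    also have "\<dots> = (\<Prod>i\<in>I. emeasure (density (M i) (f i)) (A i))"
      using A f by (intro prod.cong) (auto simp: emeasure_density)
    finally show "emeasure (density (PiM I M) (\<lambda>x. \<Prod>i\<in>I. f i (x i))) (Pi\<^sub>E I A)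
        = (\<Prod>i\<in>I. emeasure (density (M i) (f i)) (A i))" .
  qed (simp cong: sets_PiM_cong)
qed

lemma (in prob_space) has_bochner_integral_PiM_component:
  fixes f :: "'a \<Rightarrow> real"
  assumes "i \<in> I" and f: "has_bochner_integral M f a"
  shows "has_bochner_integral (PiM I (\<lambda>_. M)) (\<lambda>x. f (x i)) a"
proof -
  have "distr (PiM I (\<lambda>_. M)) M (\<lambda>x. x i) = M"
    using assms(1) by (intro distr_PiM_component prob_space_axioms)
  then have "has_bochner_integral (distr (PiM I (\<lambda>_. M)) M (\<lambda>x. x i)) f a"
    using f by simp
  moreover have "(\<lambda>x. x i) \<in> measurable (PiM I (\<lambda>_. M)) M"
    by (rule measurable_component_singleton[OF assms(1)])
  ultimately show ?thesis
    using borel_measurable_has_bochner_integral[OF f]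
    by (simp add: has_bochner_integral_iff integrable_distr_eq integral_distr)
qed

lemma (in prob_space) has_bochner_integral_PiM_mult_components:
  fixes f g :: "'a \<Rightarrow> real"
  assumes I: "finite I" "i \<in> I" "j \<in> I" "i \<noteq> j"
    and f: "has_bochner_integral M f a" and g: "has_bochner_integral M g b"
  shows "has_bochner_integral (PiM I (\<lambda>_. M)) (\<lambda>x. f (x i) * g (x j)) (a * b)"
proof -
  interpret product_sigma_finite "\<lambda>_. M" by unfold_locales
  define h where "h k y = (if k = i then f y else 1) * (if k = j then g y else 1)" for k y
  have integral_one: "has_bochner_integral M (\<lambda>_. 1 :: real) 1"
    using prob_space by (simp add: has_bochner_integral_iff)
  then have h: "has_bochner_integral M (h k) ((if k = i then a else 1) * (if k = j then b else 1))" for k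
    using f g I unfolding h_def by auto
  have "(\<Prod>k\<in>I. h k (x k)) = f (x i) * g (x j)" for x
    using I by (simp add: h_def prod.distrib)
  moreover have "(\<Prod>k\<in>I. integral\<^sup>L M (h k)) = a * b"
    using I by (simp add: has_bochner_integral_integral_eq[OF h] prod.distrib)
  ultimately show ?thesis
    using product_integrable_prod[of I h] product_integral_prod[of I h] I h
    by (simp add: has_bochner_integral_iff)
qed

lemma (in prob_space) has_bochner_integral_PiM_sum_square:
  fixes f :: "'a \<Rightarrow> real"
  assumes I: "finite I"
    and f: "has_bochner_integral M f 0" and square: "has_bochner_integral M (\<lambda>y. (f y)\<^sup>2) v"
  shows "has_bochner_integral (PiM I (\<lambda>_. M)) (\<lambda>x. (\<Sum>i\<in>I. f (x i))\<^sup>2) (real (card I) * v)"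
proof -
  have "has_bochner_integral (PiM I (\<lambda>_. M)) (\<lambda>x. f (x i) * f (x j)) (if i = j then v else 0)"
    if "i \<in> I" "j \<in> I" for i j
  proof (cases "i = j")
    case True
    then show ?thesis
      using has_bochner_integral_PiM_component[OF that(1) square] by (simp add: power2_eq_square)
  next
    case False
    then show ?thesis
      using has_bochner_integral_PiM_mult_components[OF I that False f f] by simp
  qed
  then have "has_bochner_integral (PiM I (\<lambda>_. M)) (\<lambda>x. \<Sum>i\<in>I. \<Sum>j\<in>I. f (x i) * f (x j))
      (\<Sum>i\<in>I. \<Sum>j\<in>I. if i = j then v else 0)"
    by (intro has_bochner_integral_sum)
  then show ?thesis
    using I by (simp add: power2_eq_square sum_product)
qed

lemma (in prob_space) PiM_sum_Chebyshev:
  fixes f :: "'a \<Rightarrow> real"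
  assumes "finite I" "has_bochner_integral M f 0" "has_bochner_integral M (\<lambda>y. (f y)\<^sup>2) v"
    and r: "r > 0"
  shows "measure (PiM I (\<lambda>_. M)) {x\<in>space (PiM I (\<lambda>_. M)). r \<le> \<bar>\<Sum>i\<in>I. f (x i)\<bar>} \<le> real (card I) * v / r\<^sup>2"
proof -
  interpret P: prob_space "PiM I (\<lambda>_. M)" by (intro prob_space_PiM prob_space_axioms)
  have second_moment: "has_bochner_integral (PiM I (\<lambda>_. M)) (\<lambda>x. (\<Sum>i\<in>I. f (x i))\<^sup>2) (real (card I) * v)"
    using assms(1-3) by (rule has_bochner_integral_PiM_sum_square)
  have "measure (PiM I (\<lambda>_. M)) {x\<in>space (PiM I (\<lambda>_. M)). r\<^sup>2 \<le> (\<Sum>i\<in>I. f (x i))\<^sup>2}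
      \<le> (\<integral>x. (\<Sum>i\<in>I. f (x i))\<^sup>2 \<partial>PiM I (\<lambda>_. M)) / r\<^sup>2"
    using second_moment r
    by (intro integral_Markov_inequality_measure[where A = "{}"]) (auto simp: has_bochner_integral_iff)
  moreover have "r\<^sup>2 \<le> s\<^sup>2 \<longleftrightarrow> r \<le> \<bar>s\<bar>" for s :: real
    using r by (metis abs_le_square_iff abs_of_pos)
  ultimately show ?thesis
    using second_moment by (simp add: has_bochner_integral_iff)
qed

subsection \<open>Radial densities and the uniform measure on the sphere\<close>

abbreviation vol_n :: "nat \<Rightarrow> (nat \<Rightarrow> real) set \<Rightarrow> ennreal" where
  "vol_n n \<equiv> emeasure (lebesgue_n n)"

abbreviation norm_n :: "nat \<Rightarrow> (nat \<Rightarrow> real) \<Rightarrow> real" where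
  "norm_n n x \<equiv> L2_set x {..<n}"

definition scale_n :: "nat \<Rightarrow> real \<Rightarrow> (nat \<Rightarrow> real) \<Rightarrow> nat \<Rightarrow> real" where
  "scale_n n r x = (\<lambda>i\<in>{..<n}. r * x i)"

definition sphere_proj :: "nat \<Rightarrow> (nat \<Rightarrow> real) \<Rightarrow> nat \<Rightarrow> real" where
  "sphere_proj n x = (\<lambda>i\<in>{..<n}. x i / norm_n n x)"

definition open_ball_n :: "nat \<Rightarrow> real \<Rightarrow> (nat \<Rightarrow> real) set" where
  "open_ball_n n r = {x \<in> space (lebesgue_n n). norm_n n x < r}"

definition cone_n :: "nat \<Rightarrow> (nat \<Rightarrow> real) set \<Rightarrow> bool" where
  "cone_n n C \<longleftrightarrow> (\<forall>r>0. \<forall>x\<in>space (lebesgue_n n). scale_n n r x \<in> C \<longleftrightarrow> x \<in> C)"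

definition radial_measure :: "nat \<Rightarrow> (real \<Rightarrow> ennreal) \<Rightarrow> (nat \<Rightarrow> real) measure" where
  "radial_measure n g = density (lebesgue_n n) (\<lambda>x. g (norm_n n x))"

lemma space_lebesgue_n: "space (lebesgue_n n) = ({..<n} \<rightarrow>\<^sub>E UNIV)"
  by (simp add: lebesgue_n_def space_PiM)

lemma borel_measurable_component_lebesgue_n:
  "i < n \<Longrightarrow> (\<lambda>x. x i) \<in> borel_measurable (lebesgue_n n)"
  unfolding lebesgue_n_def by measurable

lemma borel_measurable_norm_n [measurable]: "norm_n n \<in> borel_measurable (lebesgue_n n)"
  unfolding L2_set_def[abs_def] lebesgue_n_def by measurable

lemma measurable_scale_n [measurable]: "scale_n n r \<in> measurable (lebesgue_n n) (lebesgue_n n)"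
  unfolding scale_n_def[abs_def] lebesgue_n_def by measurable

lemma measurable_sphere_proj [measurable]: "sphere_proj n \<in> measurable (lebesgue_n n) (lebesgue_n n)"
proof -
  have "(\<lambda>x. \<lambda>i\<in>{..<n}. x i / norm_n n x) \<in> measurable (lebesgue_n n) (PiM {..<n} (\<lambda>_. lborel))"
    by (intro measurable_restrict)
       (auto intro!: borel_measurable_divide borel_measurable_component_lebesgue_n)
  then show ?thesis by (simp add: sphere_proj_def[abs_def] lebesgue_n_def)
qed

lemma sets_open_ball_n [measurable]: "open_ball_n n r \<in> sets (lebesgue_n n)"
  unfolding open_ball_n_def by measurable

lemma scale_n_in_space: "scale_n n r x \<in> space (lebesgue_n n)"
  by (simp add: scale_n_def space_lebesgue_n)

lemma norm_scale_n: "r \<ge> 0 \<Longrightarrow> norm_n n (scale_n n r x) = r * norm_n n x"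
  unfolding scale_n_def by (simp add: L2_set_right_distrib cong: L2_set_cong_simp)

lemma sphere_proj_scale_n: "r > 0 \<Longrightarrow> sphere_proj n (scale_n n r x) = sphere_proj n x"
  unfolding sphere_proj_def by (auto simp: norm_scale_n) (auto simp: scale_n_def fun_eq_iff)

lemma cone_n_vimage_sphere_proj: "cone_n n (sphere_proj n -` A \<inter> space (lebesgue_n n))"
  by (simp add: cone_n_def sphere_proj_scale_n scale_n_in_space)

lemma product_sigma_finite_lborel: "product_sigma_finite (\<lambda>_. lborel :: real measure)"
  by unfold_locales

lemma distr_lebesgue_n_scale_n:
  assumes r: "r > 0"
  shows "distr (lebesgue_n n) (lebesgue_n n) (scale_n n r)
    = density (lebesgue_n n) (\<lambda>_. ennreal (inverse r) ^ n)"
proof -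
  have distr_lborel: "distr lborel lborel ((*) r) = density lborel (\<lambda>_. ennreal (inverse r))"
    using lborel_distr_mult[of r] r by (simp cong: distr_cong)
  have "sigma_finite_measure (density lborel (\<lambda>_::real. ennreal (inverse r)))"
    by (subst sigma_finite_measure.sigma_finite_iff_density_finite[OF sigma_finite_lborel]) auto
  then have sigma_finite: "product_sigma_finite (\<lambda>_::nat. density lborel (\<lambda>_::real. ennreal (inverse r)))"
    by (simp add: product_sigma_finite_def)
  have "distr (lebesgue_n n) (lebesgue_n n) (scale_n n r) = PiM {..<n} (\<lambda>_. distr lborel lborel ((*) r))"
    unfolding lebesgue_n_def scale_n_def[abs_def]
    by (rule PiM_distr[symmetric])
       (auto intro: product_sigma_finite_lborel simp: distr_lborel sigma_finite)
  also have "\<dots> = density (lebesgue_n n) (\<lambda>x. \<Prod>i<n. ennreal (inverse r))"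
    unfolding distr_lborel lebesgue_n_def
    by (rule PiM_density) (auto intro: product_sigma_finite_lborel simp: sigma_finite)
  finally show ?thesis by simp
qed

lemma vol_cone_open_ball:
  assumes C [measurable]: "C \<in> sets (lebesgue_n n)" and cone: "cone_n n C" and r: "r > 0"
  shows "vol_n n (C \<inter> open_ball_n n r) = ennreal r ^ n * vol_n n (C \<inter> open_ball_n n 1)"
proof -
  have "scale_n n r -` (C \<inter> open_ball_n n r) \<inter> space (lebesgue_n n) = C \<inter> open_ball_n n 1"
    using r cone sets.sets_into_space[OF C]
    by (auto simp: cone_n_def open_ball_n_def norm_scale_n scale_n_in_space)
  then have "vol_n n (C \<inter> open_ball_n n 1)
      = emeasure (distr (lebesgue_n n) (lebesgue_n n) (scale_n n r)) (C \<inter> open_ball_n n r)"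
    by (subst emeasure_distr) auto
  also have "\<dots> = ennreal (inverse r) ^ n * vol_n n (C \<inter> open_ball_n n r)"
    unfolding distr_lebesgue_n_scale_n[OF r]
    by (subst emeasure_density) (auto simp: nn_integral_cmult_indicator)
  finally have "ennreal r ^ n * vol_n n (C \<inter> open_ball_n n 1)
      = (ennreal r ^ n * ennreal (inverse r) ^ n) * vol_n n (C \<inter> open_ball_n n r)"
    by (simp only: mult.assoc)
  also have "ennreal r ^ n * ennreal (inverse r) ^ n = 1"
    using r by (simp add: power_mult_distrib[symmetric] ennreal_mult[symmetric])
  finally show ?thesis by simp
qed

lemma vol_open_ball_finite: "vol_n n (open_ball_n n r) < \<infinity>"
proof -
  have "vol_n n (open_ball_n n r)
      \<le> vol_n n ({x. sqrt (\<Sum>i<n. (x i)\<^sup>2) \<le> max r 1} \<inter> space (lebesgue_n n))"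
    by (intro emeasure_mono) (auto simp: open_ball_n_def L2_set_def lebesgue_n_def)
  also have "\<dots> < \<infinity>"
    unfolding lebesgue_n_def by (subst emeasure_cball_aux) auto
  finally show ?thesis .
qed

lemma vol_unit_open_ball_pos: "0 < vol_n n (open_ball_n n 1)"
proof -
  have "0 < vol_n n ({x. sqrt (\<Sum>i<n. (x i)\<^sup>2) \<le> 1 / 2} \<inter> space (lebesgue_n n))"
    unfolding lebesgue_n_def by (subst emeasure_cball_aux) (auto simp: ennreal_zero_less_mult_iff)
  also have "\<dots> \<le> vol_n n (open_ball_n n 1)"
    by (intro emeasure_mono sets_open_ball_n) (auto simp: open_ball_n_def L2_set_def[symmetric])
  finally show ?thesis .
qed

text \<open>The sign turns the open balls into the half lines \<open>{r<..}\<close>, on which \<open>measure_eqI_lessThan\<close>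
  compares measures.\<close>

definition neg_norm_law :: "nat \<Rightarrow> (nat \<Rightarrow> real) set \<Rightarrow> real measure" where
  "neg_norm_law n C = distr (density (lebesgue_n n) (indicator C)) borel (\<lambda>x. - norm_n n x)"

lemma emeasure_neg_norm_law_greaterThan:
  assumes [measurable]: "C \<in> sets (lebesgue_n n)"
  shows "emeasure (neg_norm_law n C) {r<..} = vol_n n (C \<inter> open_ball_n n (- r))"
proof -
  have "emeasure (neg_norm_law n C) {r<..}
      = emeasure (density (lebesgue_n n) (indicator C))
          ((\<lambda>x. - norm_n n x) -` {r<..} \<inter> space (lebesgue_n n))"
    unfolding neg_norm_law_def by (subst emeasure_distr) auto
  also have "(\<lambda>x. - norm_n n x) -` {r<..} \<inter> space (lebesgue_n n) = open_ball_n n (- r)"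
    by (auto simp: open_ball_n_def)
  also have "emeasure (density (lebesgue_n n) (indicator C)) \<dots> = vol_n n (C \<inter> open_ball_n n (- r))"
    by (simp add: emeasure_restricted Int_commute)
  finally show ?thesis .
qed

lemma neg_norm_law_cone:
  assumes C [measurable]: "C \<in> sets (lebesgue_n n)" and cone: "cone_n n C"
  shows "scale_measure (vol_n n (open_ball_n n 1)) (neg_norm_law n C)
    = scale_measure (vol_n n (C \<inter> open_ball_n n 1)) (neg_norm_law n (space (lebesgue_n n)))"
    (is "?\<mu> = ?\<nu>")
proof (rule measure_eqI_lessThan)
  fix r
  have "vol_n n (C \<inter> open_ball_n n (- r)) < \<infinity>"
    by (intro le_less_trans[OF emeasure_mono vol_open_ball_finite]) auto
  then show "emeasure ?\<mu> {r<..} < \<infinity>"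
    using vol_open_ball_finite[of n 1]
    by (simp add: emeasure_neg_norm_law_greaterThan ennreal_mult_less_top)
  have inter_space: "space (lebesgue_n n) \<inter> open_ball_n n r = open_ball_n n r" for r
    by (auto simp: open_ball_n_def)
  show "emeasure ?\<mu> {r<..} = emeasure ?\<nu> {r<..}"
  proof (cases "r < 0")
    case True
    have "cone_n n (space (lebesgue_n n))" by (simp add: cone_n_def scale_n_in_space)
    then show ?thesis
      using vol_cone_open_ball[OF C cone, of "- r"]
        vol_cone_open_ball[of "space (lebesgue_n n)" n "- r"] True
      by (simp add: emeasure_neg_norm_law_greaterThan inter_space mult_ac)
  next
    case False
    then have "open_ball_n n (- r) = {}"
      by (auto simp: open_ball_n_def not_less intro: order_trans[OF _ L2_set_nonneg])
    then show ?thesis by (simp add: emeasure_neg_norm_law_greaterThan)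
  qed
qed (simp_all add: neg_norm_law_def)

lemma nn_integral_radial_cone:
  assumes C [measurable]: "C \<in> sets (lebesgue_n n)" and cone: "cone_n n C"
    and g [measurable]: "g \<in> borel_measurable borel"
  shows "vol_n n (open_ball_n n 1) * (\<integral>\<^sup>+x. indicator C x * g (norm_n n x) \<partial>lebesgue_n n)
    = vol_n n (C \<inter> open_ball_n n 1) * (\<integral>\<^sup>+x. g (norm_n n x) \<partial>lebesgue_n n)"
proof -
  have "(\<integral>\<^sup>+y. g (- y) \<partial>neg_norm_law n A) = (\<integral>\<^sup>+x. indicator A x * g (norm_n n x) \<partial>lebesgue_n n)"
    if [measurable]: "A \<in> sets (lebesgue_n n)" for A
    by (simp add: neg_norm_law_def nn_integral_distr nn_integral_density)
  moreover have "(\<lambda>y. g (- y)) \<in> borel_measurable (neg_norm_law n A)" for A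
    unfolding neg_norm_law_def by measurable
  ultimately show ?thesis
    using arg_cong[OF neg_norm_law_cone[OF C cone], of "\<lambda>\<mu>. \<integral>\<^sup>+y. g (- y) \<partial>\<mu>"]
    by (simp add: nn_integral_scale_measure cong: nn_integral_cong)
qed

lemma sets_radial_measure [measurable_cong]: "sets (radial_measure n g) = sets (lebesgue_n n)"
  by (simp add: radial_measure_def)

lemma space_radial_measure: "space (radial_measure n g) = space (lebesgue_n n)"
  by (simp add: radial_measure_def)

lemma emeasure_radial_measure_cone:
  assumes g [measurable]: "g \<in> borel_measurable borel"
    and P: "prob_space (radial_measure n g)"
    and C [measurable]: "C \<in> sets (lebesgue_n n)" and cone: "cone_n n C"
  shows "emeasure (radial_measure n g) C
    = vol_n n (C \<inter> open_ball_n n 1) / vol_n n (open_ball_n n 1)"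
proof -
  let ?B = "vol_n n (open_ball_n n 1)"
  have "emeasure (radial_measure n g) (space (lebesgue_n n)) = 1"
    using prob_space.emeasure_space_1[OF P] by (simp add: space_radial_measure)
  then have total: "(\<integral>\<^sup>+x. g (norm_n n x) \<partial>lebesgue_n n) = 1"
    by (simp add: radial_measure_def emeasure_density cong: nn_integral_cong)
  have "emeasure (radial_measure n g) C * ?B = vol_n n (C \<inter> open_ball_n n 1)"
    using nn_integral_radial_cone[OF C cone g]
    by (simp add: radial_measure_def emeasure_density total mult.commute)
  then show ?thesis
    using vol_unit_open_ball_pos[of n] vol_open_ball_finite[of n 1]
    by (metis ennreal_mult_divide_eq infinity_ennreal_def not_less_zero order_less_irrefl)
qed

lemma distr_sphere_proj_radial_measure_unique:
  assumes g: "g \<in> borel_measurable borel" "prob_space (radial_measure n g)"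
    and h: "h \<in> borel_measurable borel" "prob_space (radial_measure n h)"
  shows "distr (radial_measure n g) (lebesgue_n n) (sphere_proj n)
    = distr (radial_measure n h) (lebesgue_n n) (sphere_proj n)"
proof (rule measure_eqI)
  fix A assume "A \<in> sets (distr (radial_measure n g) (lebesgue_n n) (sphere_proj n))"
  then have [measurable]: "A \<in> sets (lebesgue_n n)" by simp
  have "sphere_proj n -` A \<inter> space (lebesgue_n n) \<in> sets (lebesgue_n n)" by measurable
  then show "emeasure (distr (radial_measure n g) (lebesgue_n n) (sphere_proj n)) A
      = emeasure (distr (radial_measure n h) (lebesgue_n n) (sphere_proj n)) A"
    using emeasure_radial_measure_cone[OF g _ cone_n_vimage_sphere_proj]
      emeasure_radial_measure_cone[OF h _ cone_n_vimage_sphere_proj]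
    by (simp add: emeasure_distr space_radial_measure)
qed simp

lemma sphere_unif_eq_distr_radial_measure:
  assumes g: "g \<in> borel_measurable borel" and P: "prob_space (radial_measure n g)"
  shows "sphere_unif n = distr (radial_measure n g) (lebesgue_n n) (sphere_proj n)"
proof -
  define h where "h r = indicator {..1} r / vol_n n (unit_ball_n n)" for r :: real
  have ball: "unit_ball_n n = {x \<in> space (lebesgue_n n). norm_n n x \<le> 1}"
    by (simp add: unit_ball_n_def space_lebesgue_n L2_set_def)
  have "open_ball_n n 1 \<subseteq> unit_ball_n n" "unit_ball_n n \<subseteq> open_ball_n n 2"
    "unit_ball_n n \<in> sets (lebesgue_n n)"
    unfolding ball open_ball_n_def by auto
  then have "0 < vol_n n (unit_ball_n n)" "vol_n n (unit_ball_n n) < \<infinity>"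
    using vol_unit_open_ball_pos[of n] vol_open_ball_finite[of n 2]
    by (meson emeasure_mono less_le_trans le_less_trans sets_open_ball_n)+
  then have "prob_space (uniform_measure (lebesgue_n n) (unit_ball_n n))"
    by (intro prob_space_uniform_measure) auto
  moreover have uniform: "uniform_measure (lebesgue_n n) (unit_ball_n n) = radial_measure n h"
    unfolding uniform_measure_def radial_measure_def h_def ball
    by (rule density_cong) (auto split: split_indicator)
  moreover have "h \<in> borel_measurable borel" unfolding h_def by measurable
  ultimately have "distr (uniform_measure (lebesgue_n n) (unit_ball_n n)) (lebesgue_n n) (sphere_proj n)
      = distr (radial_measure n g) (lebesgue_n n) (sphere_proj n)"
    unfolding uniform by (intro distr_sphere_proj_radial_measure_unique g P) auto
  then show ?thesis
    by (simp add: sphere_unif_def sphere_proj_def[abs_def] L2_set_def)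
qed

subsection \<open>The standard Gaussian measure\<close>

definition gauss_n :: "nat \<Rightarrow> (nat \<Rightarrow> real) measure" where
  "gauss_n n = PiM {..<n} (\<lambda>_. std_normal_distribution)"

lemma sets_gauss_n [measurable_cong]: "sets (gauss_n n) = sets (lebesgue_n n)"
  unfolding gauss_n_def lebesgue_n_def by (intro sets_PiM_cong) auto

lemma space_gauss_n: "space (gauss_n n) = space (lebesgue_n n)"
  by (rule sets_eq_imp_space_eq[OF sets_gauss_n])

lemma prob_space_gauss_n: "prob_space (gauss_n n)"
  unfolding gauss_n_def by (intro prob_space_PiM std_normal.prob_space_axioms)

definition gauss_profile :: "nat \<Rightarrow> real \<Rightarrow> ennreal" where
  "gauss_profile n r = ennreal ((1 / sqrt (2 * pi)) ^ n * exp (- r\<^sup>2 / 2))"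

lemma gauss_n_eq_radial_measure: "gauss_n n = radial_measure n (gauss_profile n)"
proof -
  have "(\<Prod>i<n. ennreal (std_normal_density (x i))) = gauss_profile n (norm_n n x)" for x
  proof -
    have "(\<Prod>i<n. std_normal_density (x i)) = (1 / sqrt (2 * pi)) ^ n * exp (\<Sum>i<n. - (x i)\<^sup>2 / 2)"
      unfolding std_normal_density_def by (subst prod.distrib, subst exp_sum) auto
    also have "(\<Sum>i<n. - (x i)\<^sup>2 / 2) = - (norm_n n x)\<^sup>2 / 2"
      by (simp add: L2_set_def sum_nonneg sum_negf sum_divide_distrib)
    finally show ?thesis by (simp add: gauss_profile_def prod_ennreal)
  qed
  moreover have "product_sigma_finite (\<lambda>_::nat. std_normal_distribution)" by unfold_locales
  ultimately show ?thesis
    unfolding gauss_n_def lebesgue_n_def radial_measure_def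
    by (subst PiM_density) (auto intro: product_sigma_finite_lborel)
qed

lemma sphere_unif_eq_distr_gauss_n: "sphere_unif n = distr (gauss_n n) (lebesgue_n n) (sphere_proj n)"
proof -
  have "gauss_profile n \<in> borel_measurable borel"
    unfolding gauss_profile_def by measurable
  then show ?thesis
    using prob_space_gauss_n[of n] unfolding gauss_n_eq_radial_measure
    by (rule sphere_unif_eq_distr_radial_measure)
qed

lemma std_normal_centred_square_moments:
  shows "has_bochner_integral std_normal_distribution (\<lambda>x. x\<^sup>2 - 1) 0"
    and "has_bochner_integral std_normal_distribution (\<lambda>x. (x\<^sup>2 - 1)\<^sup>2) 2"
proof -
  have moment: "has_bochner_integral std_normal_distribution (\<lambda>x. x ^ (2 * k))
      (fact (2 * k) / (2 ^ k * fact k))" for k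
    using std_normal_distribution_even_moments[of k] by (simp add: has_bochner_integral_iff)
  have low_moments: "has_bochner_integral std_normal_distribution (\<lambda>x. 1 :: real) 1"
    "has_bochner_integral std_normal_distribution (\<lambda>x. x\<^sup>2) 1"
    "has_bochner_integral std_normal_distribution (\<lambda>x. x ^ 4) 3"
    using moment[of 0] moment[of 1] moment[of 2] by (simp_all add: fact_numeral)
  show "has_bochner_integral std_normal_distribution (\<lambda>x. x\<^sup>2 - 1) 0"
    using has_bochner_integral_diff[OF low_moments(2,1)] by simp
  have "has_bochner_integral std_normal_distribution (\<lambda>x. x ^ 4 - 2 * x\<^sup>2 + 1) (3 - 2 * 1 + 1)"
    by (intro has_bochner_integral_add has_bochner_integral_diff
        has_bochner_integral_mult_right low_moments)
  moreover have "x ^ 4 - 2 * x\<^sup>2 + 1 = (x\<^sup>2 - 1)\<^sup>2" for x :: real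
    by algebra
  ultimately show "has_bochner_integral std_normal_distribution (\<lambda>x. (x\<^sup>2 - 1)\<^sup>2) 2"
    by simp
qed

lemma abs_minus_one_le_abs_square_minus_one:
  fixes q :: real
  assumes "0 \<le> q"
  shows "\<bar>q - 1\<bar> \<le> \<bar>q\<^sup>2 - 1\<bar>"
proof -
  have "\<bar>q\<^sup>2 - 1\<bar> = \<bar>q - 1\<bar> * (q + 1)"
    using assms by (simp add: power2_eq_square square_diff_one_factored abs_mult mult.commute)
  then show ?thesis using assms by (simp add: mult_le_cancel_left1)
qed

lemma gauss_n_norm_concentration:
  assumes n: "n > 0" and e: "e > 0"
  shows "measure (gauss_n n) {x \<in> space (gauss_n n). e \<le> \<bar>norm_n n x / sqrt n - 1\<bar>} \<le> 2 / (n * e\<^sup>2)"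
proof -
  interpret prob_space "gauss_n n" by (rule prob_space_gauss_n)
  have "n * e \<le> \<bar>\<Sum>i<n. (x i)\<^sup>2 - 1\<bar>" if "e \<le> \<bar>norm_n n x / sqrt n - 1\<bar>" for x
  proof -
    have "e \<le> \<bar>(norm_n n x / sqrt n)\<^sup>2 - 1\<bar>"
      using abs_minus_one_le_abs_square_minus_one[of "norm_n n x / sqrt n"] that by simp
    then have "n * e \<le> n * \<bar>(norm_n n x / sqrt n)\<^sup>2 - 1\<bar>"
      by (intro mult_left_mono) auto
    also have "\<dots> = \<bar>n * ((norm_n n x / sqrt n)\<^sup>2 - 1)\<bar>"
      by (simp add: abs_mult)
    also have "n * ((norm_n n x / sqrt n)\<^sup>2 - 1) = (\<Sum>i<n. (x i)\<^sup>2 - 1)"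
      using n by (simp add: L2_set_def power_divide sum_nonneg sum_subtractf right_diff_distrib)
    finally show ?thesis .
  qed
  then have "prob {x \<in> space (gauss_n n). e \<le> \<bar>norm_n n x / sqrt n - 1\<bar>}
      \<le> prob {x \<in> space (gauss_n n). n * e \<le> \<bar>\<Sum>i<n. (x i)\<^sup>2 - 1\<bar>}"
    by (intro finite_measure_mono) (auto simp: gauss_n_def)
  also have "\<dots> \<le> n * 2 / (n * e)\<^sup>2"
    unfolding gauss_n_def
    using n e
      std_normal.PiM_sum_Chebyshev[of "{..<n}", OF _ std_normal_centred_square_moments, of "n * e"]
    by simp
  also have "\<dots> = 2 / (n * e\<^sup>2)" using n by (simp add: power2_eq_square)
  finally show ?thesis .
qed

subsection \<open>Box probabilities\<close>

definition box_n :: "nat \<Rightarrow> real \<Rightarrow> real \<Rightarrow> (nat \<Rightarrow> real) set" where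
  "box_n n b a = ({..<n} \<rightarrow>\<^sub>E {-b..a})"

lemma sets_box_n: "box_n n b a \<in> sets (lebesgue_n n)"
  unfolding box_n_def lebesgue_n_def by (intro sets_PiM_I_finite) auto

lemma box_n_mono: "b \<le> b' \<Longrightarrow> a \<le> a' \<Longrightarrow> box_n n b a \<subseteq> box_n n b' a'"
  unfolding box_n_def by (intro PiE_mono) auto

lemma measure_gauss_n_box:
  assumes "- b \<le> a"
  shows "measure (gauss_n n) (box_n n b a) = (1 - (normal_tail a + normal_tail b)) ^ n"
proof -
  interpret finite_product_prob_space "\<lambda>_. std_normal_distribution" "{..<n}"
    by unfold_locales simp
  show ?thesis
    using assms by (simp add: gauss_n_def box_n_def finite_measure_PiM_emb measure_std_normal_Icc)
qed

lemma sphere_proj_mem_box_iff: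
  assumes x: "x \<in> space (lebesgue_n n)" and pos: "norm_n n x > 0"
  shows "sphere_proj n x \<in> box_n n (b / sqrt n) (a / sqrt n)
    \<longleftrightarrow> x \<in> box_n n (b * (norm_n n x / sqrt n)) (a * (norm_n n x / sqrt n))"
proof -
  have "y / norm_n n x \<le> c / sqrt n \<longleftrightarrow> y \<le> c * (norm_n n x / sqrt n)"
    "- (c / sqrt n) \<le> y / norm_n n x \<longleftrightarrow> - (c * (norm_n n x / sqrt n)) \<le> y" for c y
    using pos by (simp_all add: pos_divide_le_eq pos_le_divide_eq)
  then show ?thesis
    using x by (simp add: sphere_proj_def space_lebesgue_n box_n_def PiE_iff)
qed

lemma sphere_proj_box_between:
  fixes a b e :: real
  assumes x: "x \<in> space (lebesgue_n n)" and near: "\<bar>norm_n n x / sqrt n - 1\<bar> < e"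
    and ab: "0 \<le> a" "0 \<le> b" and e: "e < 1"
  shows "x \<in> box_n n (b * (1 - e)) (a * (1 - e)) \<Longrightarrow> sphere_proj n x \<in> box_n n (b / sqrt n) (a / sqrt n)"
    and "sphere_proj n x \<in> box_n n (b / sqrt n) (a / sqrt n) \<Longrightarrow> x \<in> box_n n (b * (1 + e)) (a * (1 + e))"
proof -
  define \<rho> where "\<rho> = norm_n n x / sqrt n"
  have \<rho>: "1 - e \<le> \<rho>" "\<rho> \<le> 1 + e"
    using near by (auto simp: \<rho>_def)
  then have "norm_n n x > 0"
    using e by (auto simp: \<rho>_def less_le)
  then have iff: "sphere_proj n x \<in> box_n n (b / sqrt n) (a / sqrt n) \<longleftrightarrow> x \<in> box_n n (b * \<rho>) (a * \<rho>)"
    unfolding \<rho>_def by (rule sphere_proj_mem_box_iff[OF x])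
  have "box_n n (b * s) (a * s) \<subseteq> box_n n (b * t) (a * t)" if "s \<le> t" for s t
    using ab that by (intro box_n_mono mult_left_mono)
  with \<rho> iff show
    "x \<in> box_n n (b * (1 - e)) (a * (1 - e)) \<Longrightarrow> sphere_proj n x \<in> box_n n (b / sqrt n) (a / sqrt n)"
    "sphere_proj n x \<in> box_n n (b / sqrt n) (a / sqrt n) \<Longrightarrow> x \<in> box_n n (b * (1 + e)) (a * (1 + e))"
    by blast+
qed

lemma sphere_unif_box_bounds:
  fixes a b e :: real
  assumes n: "n > 0" and ab: "0 \<le> a" "0 \<le> b" and e: "0 < e" "e < 1"
  defines "p \<equiv> \<lambda>s. (1 - (normal_tail (a * s) + normal_tail (b * s))) ^ n"
    and "P \<equiv> measure (sphere_unif n) (box_n n (b / sqrt n) (a / sqrt n))"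
  shows "p (1 - e) - 2 / (n * e\<^sup>2) \<le> P" "P \<le> p (1 + e) + 2 / (n * e\<^sup>2)"
proof -
  interpret prob_space "gauss_n n" by (rule prob_space_gauss_n)
  define E where "E s = box_n n (b * s) (a * s)" for s
  define S where "S = sphere_proj n -` box_n n (b / sqrt n) (a / sqrt n) \<inter> space (lebesgue_n n)"
  define N where "N = {x \<in> space (gauss_n n). e \<le> \<bar>norm_n n x / sqrt n - 1\<bar>}"
  have [measurable]: "E s \<in> events" "S \<in> events" for s
    unfolding E_def S_def sets_gauss_n by (intro measurable_sets[OF measurable_sphere_proj] sets_box_n)+
  have [measurable]: "N \<in> events" unfolding N_def by measurable
  have P_eq: "P = prob S"
    unfolding P_def sphere_unif_eq_distr_gauss_n S_def space_gauss_n[symmetric]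
    by (intro measure_distr sets_box_n) measurable
  have prob_E: "prob (E s) = p s" if "0 \<le> s" for s
    unfolding E_def p_def using ab that
    by (intro measure_gauss_n_box) (meson mult_nonneg_nonneg neg_le_0_iff_le order_trans)
  have prob_N: "prob N \<le> 2 / (n * e\<^sup>2)"
    unfolding N_def by (rule gauss_n_norm_concentration[OF n e(1)])
  have "x \<in> S \<union> N" if "x \<in> E (1 - e)" for x
    using that sphere_proj_box_between(1)[of x n e a b] ab e
    by (auto simp: E_def S_def N_def space_gauss_n box_n_def space_lebesgue_n not_le PiE_iff)
  moreover have "x \<in> E (1 + e) \<union> N" if "x \<in> S" for x
    using that sphere_proj_box_between(2)[of x n e a b] ab e
    by (auto simp: E_def S_def N_def space_gauss_n not_le)
  ultimately have "prob S \<le> prob (E (1 + e)) + prob N" "prob (E (1 - e)) \<le> prob S + prob N"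
    by (auto intro!: order_trans[OF finite_measure_mono measure_Un_le])
  then show "p (1 - e) - 2 / (n * e\<^sup>2) \<le> P" "P \<le> p (1 + e) + 2 / (n * e\<^sup>2)"
    using prob_N prob_E[of "1 + e"] prob_E[of "1 - e"] e P_eq by simp_all
qed

lemma tendsto_one_minus_power:
  fixes q :: "nat \<Rightarrow> real"
  assumes q: "(\<lambda>n. real n * q n) \<longlonglongrightarrow> L"
  shows "(\<lambda>n. (1 - q n) ^ n) \<longlonglongrightarrow> exp (- L)"
proof -
  have "(\<lambda>n. real n * q n * inverse (real n)) \<longlonglongrightarrow> L * 0"
    by (intro tendsto_intros q lim_inverse_n)
  moreover have "\<forall>\<^sub>F n in sequentially. real n * q n * inverse (real n) = q n"
    using eventually_gt_at_top[of 0] by eventually_elim simp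
  ultimately have q_tendsto_0: "q \<longlonglongrightarrow> 0" by (simp cong: filterlim_cong)
  have q_less_1: "\<forall>\<^sub>F n in sequentially. q n < 1" using order_tendstoD(2)[OF q_tendsto_0, of 1] by simp
  have "(\<lambda>n. exp (- (real n * q n) / (1 - q n))) \<longlonglongrightarrow> exp (- L / (1 - 0))"
    by (intro tendsto_intros q q_tendsto_0) simp
  then have lower: "(\<lambda>n. exp (- (q n / (1 - q n))) ^ n) \<longlonglongrightarrow> exp (- L)"
    by (simp add: exp_of_nat_mult[symmetric])
  have "(\<lambda>n. exp (- (real n * q n))) \<longlonglongrightarrow> exp (- L)"
    by (intro tendsto_intros q)
  then have upper: "(\<lambda>n. exp (- q n) ^ n) \<longlonglongrightarrow> exp (- L)"
    by (simp add: exp_of_nat_mult[symmetric])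
  show ?thesis
  proof (rule tendsto_sandwich[OF _ _ lower upper])
    show "\<forall>\<^sub>F n in sequentially. exp (- (q n / (1 - q n))) ^ n \<le> (1 - q n) ^ n"
      using q_less_1
    proof eventually_elim
      case (elim n)
      have "inverse (1 - q n) = 1 + q n / (1 - q n)" using elim by (simp add: field_simps)
      also have "\<dots> \<le> exp (q n / (1 - q n))" by (rule exp_ge_add_one_self)
      finally have "exp (- (q n / (1 - q n))) \<le> 1 - q n"
        using elim by (simp add: exp_minus inverse_le_imp_le)
      then show ?case by (intro power_mono) auto
    qed
    show "\<forall>\<^sub>F n in sequentially. (1 - q n) ^ n \<le> exp (- q n) ^ n"
      using q_less_1
    proof eventually_elim
      case (elim n)
      then show ?case using exp_ge_add_one_self[of "- q n"] by (intro power_mono) auto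
    qed
  qed
qed

lemma sphere_unif_box_tendsto:
  assumes a: "gumbel_level a x" and b: "gumbel_level b y"
  shows "(\<lambda>n. measure (sphere_unif n) (box_n n (b n / sqrt n) (a n / sqrt n)))
    \<longlonglongrightarrow> exp (- (exp (- x) + exp (- y)))" (is "?P \<longlonglongrightarrow> ?L")
proof -
  define e :: "nat \<Rightarrow> real" where "e n = real n powr (-1/4)" for n
  define p where "p n s = (1 - (normal_tail (a n * s) + normal_tail (b n * s))) ^ n" for n s
  have lim: "(\<lambda>n. p n (1 + \<delta> n)) \<longlonglongrightarrow> ?L" if "(\<lambda>n. \<delta> n * ln (real n)) \<longlonglongrightarrow> 0" for \<delta>
  proof -
    have "(\<lambda>n. real n * normal_tail (a n * (1 + \<delta> n)) + real n * normal_tail (b n * (1 + \<delta> n)))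
        \<longlonglongrightarrow> exp (- x) + exp (- y)"
      by (intro tendsto_add gumbel_level_normal_tail gumbel_level_rescale a b that)
    then show ?thesis
      unfolding p_def by (intro tendsto_one_minus_power) (simp add: distrib_left)
  qed
  have error: "(\<lambda>n. 2 / (n * (e n)\<^sup>2)) \<longlonglongrightarrow> 0" unfolding e_def by real_asymp
  have "(\<lambda>n. - e n * ln (real n)) \<longlonglongrightarrow> 0" unfolding e_def by real_asymp
  then have lower: "(\<lambda>n. p n (1 - e n) - 2 / (n * (e n)\<^sup>2)) \<longlonglongrightarrow> ?L"
    using tendsto_diff[OF lim error, of "\<lambda>n. - e n"] by simp
  have "(\<lambda>n. e n * ln (real n)) \<longlonglongrightarrow> 0" unfolding e_def by real_asymp
  then have upper: "(\<lambda>n. p n (1 + e n) + 2 / (n * (e n)\<^sup>2)) \<longlonglongrightarrow> ?L"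
    using tendsto_add[OF lim error, of e] by simp
  have "\<forall>\<^sub>F n in sequentially. 0 \<le> a n" "\<forall>\<^sub>F n in sequentially. 0 \<le> b n"
    using gumbel_level_at_top[OF a] gumbel_level_at_top[OF b] by (auto simp: filterlim_at_top)
  then have "\<forall>\<^sub>F n in sequentially.
      p n (1 - e n) - 2 / (n * (e n)\<^sup>2) \<le> ?P n \<and> ?P n \<le> p n (1 + e n) + 2 / (n * (e n)\<^sup>2)"
    using eventually_gt_at_top[of 1]
  proof eventually_elim
    case (elim n)
    then have "0 < e n" "e n < 1" by (simp_all add: e_def powr_less_one)
    then show ?case
      using elim sphere_unif_box_bounds[of n "a n" "b n" "e n"] by (simp add: p_def)
  qed
  then show ?thesis
    by (intro tendsto_sandwich[OF _ _ lower upper]) (auto elim: eventually_mono)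
qed

subsection \<open>Sums and joint distribution functions\<close>

lemma cdf_distr:
  "X \<in> borel_measurable M \<Longrightarrow> cdf (distr M borel X) x = \<P>(\<omega> in M. X \<omega> \<le> x)"
  unfolding cdf_def by (subst measure_distr) (auto intro!: arg_cong2[where f = measure])

definition joint_cdf :: "'a measure \<Rightarrow> ('a \<Rightarrow> real) \<Rightarrow> ('a \<Rightarrow> real) \<Rightarrow> real \<Rightarrow> real \<Rightarrow> real" where
  "joint_cdf M X Y x y = \<P>(\<omega> in M. X \<omega> \<le> x \<and> Y \<omega> \<le> y)"

lemma tendsto_iterated_sandwich:
  fixes f :: "'a \<Rightarrow> 'b::linorder_topology"
  assumes "G \<noteq> bot"
    and le: "\<And>m x. l m x \<le> f x" "\<And>m x. f x \<le> u m x"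
    and inner: "\<And>m. (l m \<longlongrightarrow> l' m) F" "\<And>m. (u m \<longlongrightarrow> u' m) F"
    and outer: "(l' \<longlongrightarrow> c) G" "(u' \<longlongrightarrow> c) G"
  shows "(f \<longlongrightarrow> c) F"
proof (rule order_tendstoI)
  fix y assume "y < c"
  then obtain m where "y < l' m"
    using eventually_happens'[OF \<open>G \<noteq> bot\<close> order_tendstoD(1)[OF outer(1)]] by blast
  with inner(1) have "\<forall>\<^sub>F x in F. y < l m x" by (rule order_tendstoD)
  then show "\<forall>\<^sub>F x in F. y < f x" by eventually_elim (rule less_le_trans[OF _ le(1)])
next
  fix y assume "c < y"
  then obtain m where "u' m < y"
    using eventually_happens'[OF \<open>G \<noteq> bot\<close> order_tendstoD(2)[OF outer(2)]] by blast
  with inner(2) have "\<forall>\<^sub>F x in F. u m x < y" by (rule order_tendstoD)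
  then show "\<forall>\<^sub>F x in F. f x < y" by eventually_elim (rule le_less_trans[OF le(2)])
qed

definition grid_point :: "nat \<Rightarrow> nat \<Rightarrow> real" where
  "grid_point m k = real k / real m - real m"

definition staircase :: "nat \<Rightarrow> real \<Rightarrow> (real \<times> real) set" where
  "staircase m z = (\<Union>k<2 * m * m. {grid_point m k<..grid_point m (Suc k)} \<times> {..z - grid_point m k})"

definition staircase_mass :: "(real \<Rightarrow> real \<Rightarrow> real) \<Rightarrow> nat \<Rightarrow> real \<Rightarrow> real" where
  "staircase_mass H m z = (\<Sum>k<2 * m * m. H (grid_point m (Suc k)) (z - grid_point m k)
      - H (grid_point m k) (z - grid_point m k))"

definition mass_outside_strip :: "(real \<Rightarrow> real \<Rightarrow> real) \<Rightarrow> nat \<Rightarrow> real" where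
  "mass_outside_strip H m = 1 - (H (real m) (real m) - H (- real m) (real m))"

lemma grid_point_Suc: "grid_point m (Suc k) = grid_point m k + 1 / real m"
  by (simp add: grid_point_def add_divide_distrib)

lemma grid_point_mono: "k \<le> l \<Longrightarrow> grid_point m k \<le> grid_point m l"
  by (simp add: grid_point_def divide_right_mono)

lemma ex_grid_cell:
  assumes x: "- real m < x" "x \<le> real m"
  shows "\<exists>k<2 * m * m. grid_point m k < x \<and> x \<le> grid_point m (Suc k)"
proof -
  have m_pos: "m > 0" using x by (cases m) auto
  define c where "c = \<lceil>real m * (x + real m)\<rceil>"
  have "0 < real m * (x + real m)" using m_pos x by simp
  then have c_bounds: "0 < c" "real_of_int c - 1 < real m * (x + real m)"
    "real m * (x + real m) \<le> real_of_int c"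
    unfolding c_def by (linarith | simp)+
  have "real m * (x + real m) \<le> real m * (2 * real m)"
    using x by (intro mult_left_mono) auto
  then have "c \<le> 2 * int m * int m"
    unfolding c_def by (simp add: ceiling_le_iff mult_ac)
  with c_bounds(1) have "nat (c - 1) < 2 * m * m" by (simp add: nat_less_iff)
  moreover have "grid_point m (nat (c - 1)) < x" "x \<le> grid_point m (Suc (nat (c - 1)))"
    using c_bounds m_pos by (simp_all add: grid_point_def field_simps)
  ultimately show ?thesis by blast
qed

lemma sets_staircase [measurable]: "staircase m z \<in> sets (borel \<Otimes>\<^sub>M borel)"
  unfolding staircase_def by (intro sets.finite_UN pair_measureI) auto

lemma staircase_subset_half_plane: "(x, y) \<in> staircase m z \<Longrightarrow> x + y \<le> z + 1 / real m"
  by (auto simp: staircase_def grid_point_Suc)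

lemma mem_staircase:
  assumes "- real m < x" "x \<le> real m" "x + y \<le> z"
  shows "(x, y) \<in> staircase m z"
proof -
  obtain k where "k < 2 * m * m" "grid_point m k < x" "x \<le> grid_point m (Suc k)"
    using ex_grid_cell[OF assms(1,2)] by blast
  with assms(3) show ?thesis unfolding staircase_def by force
qed

context prob_space
begin

context
  fixes X Y :: "'a \<Rightarrow> real"
  assumes X [measurable]: "X \<in> borel_measurable M" and Y [measurable]: "Y \<in> borel_measurable M"
begin

lemma prob_strip:
  assumes "s \<le> t"
  shows "\<P>(\<omega> in M. s < X \<omega> \<and> X \<omega> \<le> t \<and> Y \<omega> \<le> y) = joint_cdf M X Y t y - joint_cdf M X Y s y"
proof -
  have "{\<omega> \<in> space M. s < X \<omega> \<and> X \<omega> \<le> t \<and> Y \<omega> \<le> y}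
      = {\<omega> \<in> space M. X \<omega> \<le> t \<and> Y \<omega> \<le> y} - {\<omega> \<in> space M. X \<omega> \<le> s \<and> Y \<omega> \<le> y}"
    by auto
  also have "prob \<dots> = joint_cdf M X Y t y - joint_cdf M X Y s y"
    unfolding joint_cdf_def using assms by (intro finite_measure_Diff) auto
  finally show ?thesis .
qed

lemma staircase_mass_eq_prob:
  "staircase_mass (joint_cdf M X Y) m z = \<P>(\<omega> in M. (X \<omega>, Y \<omega>) \<in> staircase m z)"
proof -
  define A where "A k = {\<omega> \<in> space M. grid_point m k < X \<omega> \<and> X \<omega> \<le> grid_point m (Suc k)
      \<and> Y \<omega> \<le> z - grid_point m k}" for k
  have "A k \<inter> A l = {}" if "k < l" for k l
    using grid_point_mono[of "Suc k" l m] that by (auto simp: A_def)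
  then have "disjoint_family_on A {..<2 * m * m}"
    unfolding disjoint_family_on_def by (metis Int_commute nat_neq_iff)
  moreover have "A k \<in> events" for k unfolding A_def by measurable
  ultimately have "prob (\<Union>k<2 * m * m. A k) = (\<Sum>k<2 * m * m. prob (A k))"
    by (intro finite_measure_finite_Union) auto
  also have "\<dots> = staircase_mass (joint_cdf M X Y) m z"
    by (simp add: A_def staircase_mass_def prob_strip grid_point_mono)
  also have "(\<Union>k<2 * m * m. A k) = {\<omega> \<in> space M. (X \<omega>, Y \<omega>) \<in> staircase m z}"
    by (auto simp: staircase_def A_def)
  finally show ?thesis ..
qed

lemma staircase_mass_le_cdf_add:
  "staircase_mass (joint_cdf M X Y) m z \<le> cdf (distr M borel (\<lambda>\<omega>. X \<omega> + Y \<omega>)) (z + 1 / real m)"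
  unfolding staircase_mass_eq_prob cdf_distr[OF borel_measurable_add[OF X Y]]
  by (intro finite_measure_mono) (auto dest: staircase_subset_half_plane)

lemma cdf_add_le_staircase_mass:
  "cdf (distr M borel (\<lambda>\<omega>. X \<omega> + Y \<omega>)) z
    \<le> staircase_mass (joint_cdf M X Y) m z + mass_outside_strip (joint_cdf M X Y) m"
proof -
  let ?S = "{\<omega> \<in> space M. (X \<omega>, Y \<omega>) \<in> staircase m z}"
  let ?B = "{\<omega> \<in> space M. - real m < X \<omega> \<and> X \<omega> \<le> real m \<and> Y \<omega> \<le> real m}"
  have "{\<omega> \<in> space M. X \<omega> + Y \<omega> \<le> z} \<subseteq> ?S \<union> (space M - ?B)"
    by (auto intro: mem_staircase)
  then have "cdf (distr M borel (\<lambda>\<omega>. X \<omega> + Y \<omega>)) z \<le> prob (?S \<union> (space M - ?B))"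
    unfolding cdf_distr[OF borel_measurable_add[OF X Y]]
    by (intro finite_measure_mono) auto
  also have "\<dots> \<le> prob ?S + prob (space M - ?B)"
    by (intro measure_Un_le) auto
  also have "prob (space M - ?B) = mass_outside_strip (joint_cdf M X Y) m"
    by (subst prob_compl) (auto simp: prob_strip mass_outside_strip_def)
  finally show ?thesis by (simp only: staircase_mass_eq_prob)
qed

lemma mass_outside_strip_tendsto_0: "mass_outside_strip (joint_cdf M X Y) \<longlonglongrightarrow> 0"
proof -
  let ?B = "\<lambda>m::nat. {\<omega> \<in> space M. - real m < X \<omega> \<and> X \<omega> \<le> real m \<and> Y \<omega> \<le> real m}"
  have "(\<Union>m. ?B m) = space M"
  proof (intro equalityI subsetI)
    fix \<omega> assume "\<omega> \<in> space M"
    moreover obtain m :: nat where "max \<bar>X \<omega>\<bar> (Y \<omega>) < real m" using reals_Archimedean2 by blast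
    ultimately show "\<omega> \<in> (\<Union>m. ?B m)" by (auto intro!: exI[of _ m])
  qed auto
  moreover have "incseq ?B" by (auto simp: incseq_def)
  ultimately have "(\<lambda>m. prob (?B m)) \<longlonglongrightarrow> 1"
    using finite_Lim_measure_incseq[of ?B] prob_space by (auto simp: image_subset_iff)
  then have "(\<lambda>m. 1 - prob (?B m)) \<longlonglongrightarrow> 1 - 1" by (intro tendsto_intros)
  then show ?thesis by (simp add: prob_strip mass_outside_strip_def[abs_def])
qed

lemma staircase_mass_tendsto:
  assumes cont: "isCont (cdf (distr M borel (\<lambda>\<omega>. X \<omega> + Y \<omega>))) z"
  shows "(\<lambda>m. staircase_mass (joint_cdf M X Y) m (z - 1 / real m))
      \<longlonglongrightarrow> cdf (distr M borel (\<lambda>\<omega>. X \<omega> + Y \<omega>)) z"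
    and "(\<lambda>m. staircase_mass (joint_cdf M X Y) m z) \<longlonglongrightarrow> cdf (distr M borel (\<lambda>\<omega>. X \<omega> + Y \<omega>)) z"
proof -
  let ?F = "cdf (distr M borel (\<lambda>\<omega>. X \<omega> + Y \<omega>))" and ?H = "joint_cdf M X Y"
  have diff_le: "?F y - mass_outside_strip ?H m \<le> staircase_mass ?H m y" for m y
    using cdf_add_le_staircase_mass[of y m] by simp
  have shifted_lower: "(\<lambda>m. ?F (z - 1 / real m) - mass_outside_strip ?H m) \<longlonglongrightarrow> ?F z - 0"
    by (intro tendsto_diff mass_outside_strip_tendsto_0 isCont_tendsto_compose[OF cont]) real_asymp
  have "staircase_mass ?H m (z - 1 / real m) \<le> ?F z" for m
    using staircase_mass_le_cdf_add[of m "z - 1 / real m"] by simp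
  then show "(\<lambda>m. staircase_mass ?H m (z - 1 / real m)) \<longlonglongrightarrow> ?F z"
    using tendsto_sandwich[OF _ _ shifted_lower[unfolded diff_0_right] tendsto_const] diff_le by simp
  have lower: "(\<lambda>m. ?F z - mass_outside_strip ?H m) \<longlonglongrightarrow> ?F z - 0"
    by (intro tendsto_diff tendsto_const mass_outside_strip_tendsto_0)
  have upper: "(\<lambda>m. ?F (z + 1 / real m)) \<longlonglongrightarrow> ?F z"
    by (intro isCont_tendsto_compose[OF cont]) real_asymp
  show "(\<lambda>m. staircase_mass ?H m z) \<longlonglongrightarrow> ?F z"
    using tendsto_sandwich[OF _ _ lower[unfolded diff_0_right] upper] diff_le staircase_mass_le_cdf_add
    by simp
qed

end

end

lemma weak_conv_m_add:
  fixes M :: "nat \<Rightarrow> 'a measure" and X Y :: "nat \<Rightarrow> 'a \<Rightarrow> real"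
  assumes M: "\<And>n. prob_space (M n)" "\<And>n. X n \<in> borel_measurable (M n)" "\<And>n. Y n \<in> borel_measurable (M n)"
    and N: "prob_space N" "X' \<in> borel_measurable N" "Y' \<in> borel_measurable N"
    and lim: "\<And>x y. (\<lambda>n. joint_cdf (M n) (X n) (Y n) x y) \<longlonglongrightarrow> joint_cdf N X' Y' x y"
  shows "weak_conv_m (\<lambda>n. distr (M n) borel (\<lambda>\<omega>. X n \<omega> + Y n \<omega>)) (distr N borel (\<lambda>\<omega>. X' \<omega> + Y' \<omega>))"
  unfolding weak_conv_m_def weak_conv_def
proof (intro allI impI)
  let ?F = "\<lambda>n. cdf (distr (M n) borel (\<lambda>\<omega>. X n \<omega> + Y n \<omega>))"
  let ?F' = "cdf (distr N borel (\<lambda>\<omega>. X' \<omega> + Y' \<omega>))"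
  let ?H = "\<lambda>n. joint_cdf (M n) (X n) (Y n)" and ?H' = "joint_cdf N X' Y'"
  fix z assume cont: "isCont ?F' z"
  have staircase: "(\<lambda>n. staircase_mass (?H n) m y) \<longlonglongrightarrow> staircase_mass ?H' m y" for m y
    unfolding staircase_mass_def by (intro tendsto_intros lim)
  have outside: "(\<lambda>n. mass_outside_strip (?H n) m) \<longlonglongrightarrow> mass_outside_strip ?H' m" for m
    unfolding mass_outside_strip_def by (intro tendsto_intros lim)
  note limit_staircase = prob_space.staircase_mass_tendsto[OF N cont]
  show "(\<lambda>n. ?F n z) \<longlonglongrightarrow> ?F' z"
  proof (rule tendsto_iterated_sandwich)
    show "staircase_mass (?H n) m (z - 1 / real m) \<le> ?F n z" for m n
      using prob_space.staircase_mass_le_cdf_add[OF M, of n m "z - 1 / real m"] by simp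
    show "?F n z \<le> staircase_mass (?H n) m z + mass_outside_strip (?H n) m" for m n
      using prob_space.cdf_add_le_staircase_mass[OF M] by simp
    show "(\<lambda>n. staircase_mass (?H n) m (z - 1 / real m)) \<longlonglongrightarrow> staircase_mass ?H' m (z - 1 / real m)" for m
      by (rule staircase)
    show "(\<lambda>n. staircase_mass (?H n) m z + mass_outside_strip (?H n) m)
        \<longlonglongrightarrow> staircase_mass ?H' m z + mass_outside_strip ?H' m" for m
      by (intro tendsto_add staircase outside)
    show "(\<lambda>m. staircase_mass ?H' m (z - 1 / real m)) \<longlonglongrightarrow> ?F' z"
      by (rule limit_staircase(1))
    show "(\<lambda>m. staircase_mass ?H' m z + mass_outside_strip ?H' m) \<longlonglongrightarrow> ?F' z"
      using tendsto_add[OF limit_staircase(2) prob_space.mass_outside_strip_tendsto_0[OF N]] by simp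
  qed simp
qed

lemma weak_conv_m_add_convolution:
  fixes M :: "nat \<Rightarrow> 'a measure" and X Y :: "nat \<Rightarrow> 'a \<Rightarrow> real"
  assumes M: "\<And>n. prob_space (M n)" "\<And>n. X n \<in> borel_measurable (M n)" "\<And>n. Y n \<in> borel_measurable (M n)"
    and G: "real_distribution G" and H: "real_distribution H"
    and lim: "\<And>x y. (\<lambda>n. joint_cdf (M n) (X n) (Y n) x y) \<longlonglongrightarrow> cdf G x * cdf H y"
  shows "weak_conv_m (\<lambda>n. distr (M n) borel (\<lambda>\<omega>. X n \<omega> + Y n \<omega>)) (G \<star> H)"
proof -
  interpret G: real_distribution G by fact
  interpret H: real_distribution H by fact
  interpret GH: pair_prob_space G H ..
  have "joint_cdf (G \<Otimes>\<^sub>M H) fst snd x y = cdf G x * cdf H y" for x y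
  proof -
    have "{\<omega> \<in> space (G \<Otimes>\<^sub>M H). fst \<omega> \<le> x \<and> snd \<omega> \<le> y} = {..x} \<times> {..y}"
      by (auto simp: space_pair_measure)
    then show ?thesis
      by (simp add: joint_cdf_def cdf_def measure_def H.emeasure_pair_measure_Times enn2real_mult)
  qed
  then have "weak_conv_m (\<lambda>n. distr (M n) borel (\<lambda>\<omega>. X n \<omega> + Y n \<omega>))
      (distr (G \<Otimes>\<^sub>M H) borel (\<lambda>\<omega>. fst \<omega> + snd \<omega>))"
    using lim by (intro weak_conv_m_add M GH.prob_space_axioms) auto
  then show ?thesis by (simp add: convolution_def case_prod_beta')
qed

lemma cdf_distr_mult:
  fixes M :: "real measure"
  assumes "sets M = sets borel" "c > 0"
  shows "cdf (distr M borel ((*) c)) x = cdf M (x / c)"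
proof -
  have "(*) c -` {..x} \<inter> space M = {..x / c}"
    using assms sets_eq_imp_space_eq[OF assms(1)] by (auto simp: pos_le_divide_eq mult.commute)
  moreover have "(*) c \<in> borel_measurable M"
    by (simp add: measurable_cong_sets[OF assms(1) refl])
  ultimately show ?thesis
    unfolding cdf_def by (subst measure_distr) auto
qed

lemma weak_conv_m_distr_mult:
  fixes M :: "nat \<Rightarrow> real measure" and N :: "real measure"
  assumes conv: "weak_conv_m M N" and c: "c > 0"
    and sets: "\<And>n. sets (M n) = sets borel" "sets N = sets borel"
  shows "weak_conv_m (\<lambda>n. distr (M n) borel ((*) c)) (distr N borel ((*) c))"
  unfolding weak_conv_m_def weak_conv_def
proof (intro allI impI)
  fix x assume cont: "isCont (cdf (distr N borel ((*) c))) x"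
  have "isCont ((*) c) (x / c)" by (intro continuous_intros)
  moreover have "isCont (cdf (distr N borel ((*) c))) (c * (x / c))" using c cont by simp
  ultimately have "isCont (\<lambda>y. cdf (distr N borel ((*) c)) (c * y)) (x / c)" by (rule isCont_o2)
  then have "isCont (cdf N) (x / c)"
    using c by (simp add: cdf_distr_mult[OF sets(2) c])
  then have "(\<lambda>n. cdf (M n) (x / c)) \<longlonglongrightarrow> cdf N (x / c)"
    using conv by (simp add: weak_conv_m_def weak_conv_def)
  then show "(\<lambda>n. cdf (distr (M n) borel ((*) c)) x) \<longlonglongrightarrow> cdf (distr N borel ((*) c)) x"
    using sets c by (simp add: cdf_distr_mult)
qed

subsection \<open>Widths of polytopes\<close>

lemma inner_n_convex_combination:
  "inner_n n U (\<lambda>j. \<Sum>v\<in>F. a v * v j) = (\<Sum>v\<in>F. a v * inner_n n U v)"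
proof -
  have "inner_n n U (\<lambda>j. \<Sum>v\<in>F. a v * v j) = (\<Sum>i<n. \<Sum>v\<in>F. a v * (U i * v i))"
    by (simp add: inner_n_def sum_distrib_left mult_ac)
  also have "\<dots> = (\<Sum>v\<in>F. \<Sum>i<n. a v * (U i * v i))" by (rule sum.swap)
  finally show ?thesis by (simp add: inner_n_def sum_distrib_left)
qed

lemma subset_conv_fin: "V \<subseteq> conv_fin V"
proof
  fix v assume "v \<in> V"
  then show "v \<in> conv_fin V"
    unfolding conv_fin_def by (auto intro!: exI[of _ "{v}"] exI[of _ "\<lambda>_. 1"])
qed

lemma inner_n_conv_fin_bounds:
  assumes V: "\<And>v. v \<in> V \<Longrightarrow> l \<le> inner_n n U v \<and> inner_n n U v \<le> u" and t: "t \<in> conv_fin V"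
  shows "l \<le> inner_n n U t \<and> inner_n n U t \<le> u"
proof -
  obtain F a where F: "F \<subseteq> V" "\<forall>v\<in>F. a v \<ge> 0" "sum a F = 1" and t_eq: "t = (\<lambda>j. \<Sum>v\<in>F. a v * v j)"
    using t unfolding conv_fin_def by blast
  have "(\<Sum>v\<in>F. a v * l) \<le> (\<Sum>v\<in>F. a v * inner_n n U v)" "(\<Sum>v\<in>F. a v * inner_n n U v) \<le> (\<Sum>v\<in>F. a v * u)"
    using F V by (auto intro!: sum_mono mult_left_mono)
  then show ?thesis
    using F by (simp add: t_eq inner_n_convex_combination sum_distrib_right[symmetric])
qed

lemma width_n_conv_fin:
  assumes V: "finite V" "V \<noteq> {}"
  shows "width_n n (conv_fin V) U = Max (inner_n n U ` V) - Min (inner_n n U ` V)"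
proof -
  have "Max (inner_n n U ` V) \<in> inner_n n U ` V" "Min (inner_n n U ` V) \<in> inner_n n U ` V"
    using V by (auto intro!: Max_in Min_in)
  then have "Max (inner_n n U ` V) \<in> inner_n n U ` conv_fin V"
    "Min (inner_n n U ` V) \<in> inner_n n U ` conv_fin V"
    using subset_conv_fin[of V] by blast+
  moreover have "Min (inner_n n U ` V) \<le> inner_n n U t \<and> inner_n n U t \<le> Max (inner_n n U ` V)"
    if "t \<in> conv_fin V" for t
    using V by (intro inner_n_conv_fin_bounds[OF _ that]) auto
  ultimately have "(SUP t\<in>conv_fin V. inner_n n U t) = Max (inner_n n U ` V)"
    "(INF t\<in>conv_fin V. inner_n n U t) = Min (inner_n n U ` V)"
    by (auto intro!: cSup_eq_maximum cInf_eq_minimum)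
  then show ?thesis by (simp add: width_n_def)
qed

lemma inner_n_scaled_std_basis:
  assumes "i < n"
  shows "inner_n n U (\<lambda>j. s * std_basis i j) = s * U i"
proof -
  have "inner_n n U (\<lambda>j. s * std_basis i j) = (\<Sum>j<n. if j = i then s * U i else 0)"
    unfolding inner_n_def std_basis_def by (intro sum.cong) auto
  then show ?thesis using assms by simp
qed

lemma width_simplex_n:
  assumes "n > 0"
  shows "width_n n (simplex_n n) U = Max (U ` {..<n}) - Min (U ` {..<n})"
proof -
  have "inner_n n U ` std_basis ` {..<n} = U ` {..<n}"
    unfolding image_image using inner_n_scaled_std_basis[of _ n U 1] by (intro image_cong) auto
  then show ?thesis
    unfolding simplex_n_def using assms by (subst width_n_conv_fin) auto
qed

lemma width_crosspoly_n:
  assumes "n > 0"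
  shows "width_n n (crosspoly_n n) U = 2 * Max ((\<lambda>i. \<bar>U i\<bar>) ` {..<n})"
proof -
  define m where "m = Max ((\<lambda>i. \<bar>U i\<bar>) ` {..<n})"
  define W where "W = (\<lambda>(s, i). s * U i) ` ({1, -1} \<times> {..<n})"
  have image: "inner_n n U ` (\<lambda>(s, i). (\<lambda>j. s * std_basis i j)) ` ({1, -1} \<times> {..<n}) = W"
    unfolding W_def image_image
    by (rule image_cong[OF refl]) (use inner_n_scaled_std_basis[of _ n U] in \<open>auto simp del: insert_iff\<close>)
  have W: "W = U ` {..<n} \<union> (\<lambda>i. - U i) ` {..<n}"
    unfolding W_def by force
  have "m \<in> (\<lambda>i. \<bar>U i\<bar>) ` {..<n}"
    unfolding m_def using assms by (intro Max_in) auto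
  then have "m \<in> W" "- m \<in> W"
    by (auto simp: W abs_if)
  moreover have "\<bar>U i\<bar> \<le> m" if "i < n" for i
    unfolding m_def using that by (intro Max_ge) auto
  then have "w \<le> m \<and> - m \<le> w" if "w \<in> W" for w
    using that by (force simp: W)
  ultimately have "Max W = m" "Min W = - m"
    by (auto intro!: Max_eqI Min_eqI simp: W)
  then show ?thesis
    unfolding crosspoly_n_def using assms by (subst width_n_conv_fin) (auto simp: image m_def)
qed

subsection \<open>Extreme coordinates of a random direction\<close>

lemma prob_space_sphere_unif: "prob_space (sphere_unif n)"
  unfolding sphere_unif_eq_distr_gauss_n
  by (rule prob_space.prob_space_distr[OF prob_space_gauss_n]) measurable

lemma sets_sphere_unif [measurable_cong]: "sets (sphere_unif n) = sets (lebesgue_n n)"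
  by (simp add: sphere_unif_def)

lemma space_sphere_unif: "space (sphere_unif n) = ({..<n} \<rightarrow>\<^sub>E UNIV)"
  by (simp add: sphere_unif_def space_lebesgue_n)

lemma borel_measurable_component_sphere_unif:
  "i < n \<Longrightarrow> (\<lambda>U. U i) \<in> borel_measurable (sphere_unif n)"
  using borel_measurable_component_lebesgue_n
  by (simp cong: measurable_cong_sets[OF sets_sphere_unif refl])

definition fluctuation :: "nat \<Rightarrow> real \<Rightarrow> real \<Rightarrow> real" where
  "fluctuation n u w = sqrt (2 * real n * ln n) * (w - u / sqrt n)"

lemma fluctuation_le_iff:
  assumes "n > 1"
  shows "fluctuation n u w \<le> x \<longleftrightarrow> w \<le> (u + x / sqrt (2 * ln n)) / sqrt n"
proof -
  define r t where "r = sqrt (real n)" and "t = sqrt (2 * ln (real n))"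
  have pos: "r > 0" "t > 0" using assms by (auto simp: r_def t_def)
  have "fluctuation n u w = (r * w - u) * t"
    using pos by (simp add: fluctuation_def r_def t_def real_sqrt_mult field_simps)
  then have "fluctuation n u w \<le> x \<longleftrightarrow> r * w - u \<le> x / t"
    using pos by (simp only: pos_le_divide_eq)
  also have "\<dots> \<longleftrightarrow> w * r \<le> u + x / t" by (auto simp: algebra_simps)
  also have "\<dots> \<longleftrightarrow> w \<le> (u + x / t) / r" using pos by (simp only: pos_le_divide_eq)
  finally show ?thesis by (simp only: r_def t_def)
qed

definition max_fluctuation :: "nat \<Rightarrow> (nat \<Rightarrow> real) \<Rightarrow> real" where
  "max_fluctuation n U = fluctuation n (u_seq n) (Max (U ` {..<n}))"

definition min_fluctuation :: "nat \<Rightarrow> (nat \<Rightarrow> real) \<Rightarrow> real" where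
  "min_fluctuation n U = fluctuation n (u_seq n) (- Min (U ` {..<n}))"

definition max_abs_fluctuation :: "nat \<Rightarrow> (nat \<Rightarrow> real) \<Rightarrow> real" where
  "max_abs_fluctuation n U = fluctuation n (u_seq (2 * n)) (Max ((\<lambda>i. \<bar>U i\<bar>) ` {..<n}))"

lemma borel_measurable_fluctuations [measurable]:
  "max_fluctuation n \<in> borel_measurable (sphere_unif n)"
  "min_fluctuation n \<in> borel_measurable (sphere_unif n)"
  "max_abs_fluctuation n \<in> borel_measurable (sphere_unif n)"
proof -
  have [measurable]: "(\<lambda>U. Max (U ` {..<n})) \<in> borel_measurable (sphere_unif n)"
    "(\<lambda>U. Min (U ` {..<n})) \<in> borel_measurable (sphere_unif n)"
    "(\<lambda>U. Max ((\<lambda>i. \<bar>U i\<bar>) ` {..<n})) \<in> borel_measurable (sphere_unif n)"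
    using borel_measurable_Max[of "{..<n}" "\<lambda>i U. U i" "sphere_unif n"]
      borel_measurable_Min[of "{..<n}" "\<lambda>i U. U i" "sphere_unif n"]
      borel_measurable_Max[of "{..<n}" "\<lambda>i U. \<bar>U i\<bar>" "sphere_unif n"]
    by (simp_all add: borel_measurable_component_sphere_unif borel_measurable_abs)
  show "max_fluctuation n \<in> borel_measurable (sphere_unif n)"
    "min_fluctuation n \<in> borel_measurable (sphere_unif n)"
    "max_abs_fluctuation n \<in> borel_measurable (sphere_unif n)"
    unfolding max_fluctuation_def[abs_def] min_fluctuation_def[abs_def] max_abs_fluctuation_def[abs_def]
      fluctuation_def
    by measurable
qed

lemma scaled_width_simplex_n:
  "sqrt (2 * real n * ln (real n)) * (width_n n (simplex_n n) U - 2 * u_seq n / sqrt (real n))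
    = max_fluctuation n U + min_fluctuation n U"
  by (cases "n = 0")
     (simp_all add: max_fluctuation_def min_fluctuation_def fluctuation_def width_simplex_n algebra_simps)

lemma scaled_width_crosspoly_n:
  "sqrt (2 * real n * ln (real n)) * (width_n n (crosspoly_n n) U - 2 * u_seq (2 * n) / sqrt (real n))
    = 2 * max_abs_fluctuation n U"
  by (cases "n = 0")
     (simp_all add: max_abs_fluctuation_def fluctuation_def width_crosspoly_n algebra_simps)

lemma joint_cdf_max_min_fluctuation_tendsto:
  "(\<lambda>n. joint_cdf (sphere_unif n) (max_fluctuation n) (min_fluctuation n) x y)
    \<longlonglongrightarrow> exp (- exp (- x)) * exp (- exp (- y))"
proof -
  define a where "a z n = u_seq n + z / sqrt (2 * ln n)" for z and n :: nat
  have "(\<lambda>n. measure (sphere_unif n) (box_n n (a y n / sqrt n) (a x n / sqrt n)))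
      \<longlonglongrightarrow> exp (- (exp (- x) + exp (- y)))"
    unfolding a_def by (intro sphere_unif_box_tendsto gumbel_level_u_seq)
  moreover have "\<forall>\<^sub>F n in sequentially.
      measure (sphere_unif n) (box_n n (a y n / sqrt n) (a x n / sqrt n))
      = joint_cdf (sphere_unif n) (max_fluctuation n) (min_fluctuation n) x y"
    using eventually_gt_at_top[of 1]
  proof eventually_elim
    case (elim n)
    then have ne: "{..<n} \<noteq> {}" by auto
    have "max_fluctuation n U \<le> x \<longleftrightarrow> (\<forall>i<n. U i \<le> a x n / sqrt n)" for U
      unfolding max_fluctuation_def fluctuation_le_iff[OF elim] a_def using ne by (subst Max_le_iff) auto
    moreover have "min_fluctuation n U \<le> y \<longleftrightarrow> (\<forall>i<n. - (a y n / sqrt n) \<le> U i)" for U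
      unfolding min_fluctuation_def fluctuation_le_iff[OF elim] a_def minus_le_iff[of "Min _"]
      using ne by (subst Min_ge_iff) auto
    ultimately have "{U \<in> space (sphere_unif n). max_fluctuation n U \<le> x \<and> min_fluctuation n U \<le> y}
        = box_n n (a y n / sqrt n) (a x n / sqrt n)"
      unfolding space_sphere_unif box_n_def by (simp add: set_eq_iff PiE_iff Ball_def) blast
    then show ?case by (simp only: joint_cdf_def)
  qed
  ultimately show ?thesis
    unfolding minus_add_distrib exp_add by (rule Lim_transform_eventually)
qed

lemma prob_max_abs_fluctuation_tendsto:
  "(\<lambda>n. \<P>(U in sphere_unif n. max_abs_fluctuation n U \<le> x)) \<longlonglongrightarrow> exp (- exp (- x))"
proof -
  define a where "a n = u_seq (2 * n) + x / sqrt (2 * ln n)" for n :: nat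
  have "(\<lambda>n. measure (sphere_unif n) (box_n n (a n / sqrt n) (a n / sqrt n)))
      \<longlonglongrightarrow> exp (- (exp (- (ln 2 + x)) + exp (- (ln 2 + x))))"
    unfolding a_def by (intro sphere_unif_box_tendsto gumbel_level_u_seq_double)
  moreover have "exp (- (ln 2 + x)) + exp (- (ln 2 + x)) = exp (- x)"
    by (simp add: exp_diff exp_minus inverse_eq_divide)
  moreover have "\<forall>\<^sub>F n in sequentially.
      measure (sphere_unif n) (box_n n (a n / sqrt n) (a n / sqrt n))
      = \<P>(U in sphere_unif n. max_abs_fluctuation n U \<le> x)"
    using eventually_gt_at_top[of 1]
  proof eventually_elim
    case (elim n)
    then have ne: "{..<n} \<noteq> {}" by auto
    have "max_abs_fluctuation n U \<le> x \<longleftrightarrow> (\<forall>i<n. \<bar>U i\<bar> \<le> a n / sqrt n)" for U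
      unfolding max_abs_fluctuation_def fluctuation_le_iff[OF elim] a_def
      using ne by (subst Max_le_iff) auto
    then have "{U \<in> space (sphere_unif n). max_abs_fluctuation n U \<le> x}
        = box_n n (a n / sqrt n) (a n / sqrt n)"
      unfolding space_sphere_unif box_n_def
      by (simp add: set_eq_iff PiE_iff Ball_def abs_le_iff minus_le_iff) blast
    then show ?case by (simp only:)
  qed
  ultimately show ?thesis
    by (simp add: Lim_transform_eventually)
qed

theorem theorem3p3:
  fixes G :: "real measure"
  assumes "real_distribution G"
    and "\<And>x. cdf G x = exp (- exp (- x))"
  shows "weak_conv_m
           (\<lambda>n. distr (sphere_unif n) borel
              (\<lambda>U. sqrt (2 * real n * ln (real n)) *
                   (width_n n (simplex_n n) U - 2 * u_seq n / sqrt (real n))))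
           (G \<star> G)
       \<and> weak_conv_m
           (\<lambda>n. distr (sphere_unif n) borel
              (\<lambda>U. sqrt (2 * real n * ln (real n)) *
                   (width_n n (crosspoly_n n) U - 2 * u_seq (2 * n) / sqrt (real n))))
           (distr G borel (\<lambda>x. 2 * x))"
proof
  have "weak_conv_m (\<lambda>n. distr (sphere_unif n) borel (\<lambda>U. max_fluctuation n U + min_fluctuation n U))
      (G \<star> G)"
    using joint_cdf_max_min_fluctuation_tendsto
    by (intro weak_conv_m_add_convolution prob_space_sphere_unif borel_measurable_fluctuations assms(1))
       (simp add: assms(2))
  then show "weak_conv_m (\<lambda>n. distr (sphere_unif n) borel (\<lambda>U. sqrt (2 * real n * ln (real n)) *
      (width_n n (simplex_n n) U - 2 * u_seq n / sqrt (real n)))) (G \<star> G)"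
    by (simp only: scaled_width_simplex_n)
  have "weak_conv_m (\<lambda>n. distr (sphere_unif n) borel (max_abs_fluctuation n)) G"
    using prob_max_abs_fluctuation_tendsto
    by (simp add: weak_conv_m_def weak_conv_def cdf_distr assms(2))
  then have "weak_conv_m (\<lambda>n. distr (distr (sphere_unif n) borel (max_abs_fluctuation n)) borel ((*) 2))
      (distr G borel ((*) 2))"
    using real_distribution.events_eq_borel[OF assms(1)] by (intro weak_conv_m_distr_mult) auto
  then show "weak_conv_m (\<lambda>n. distr (sphere_unif n) borel (\<lambda>U. sqrt (2 * real n * ln (real n)) *
      (width_n n (crosspoly_n n) U - 2 * u_seq (2 * n) / sqrt (real n)))) (distr G borel (\<lambda>x. 2 * x))"
    by (simp add: scaled_width_crosspoly_n distr_distr comp_def)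
qed

end
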